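(* Given any integer $k\ge 1$ and any $\theta_1\in(\pi/4,\pi/2)$, there exists a constant $A_k>0$ such that for every $\lambda<-A_k$ the problem $$u''(\theta)+2\,\frac{\cos(2\theta)}{\sin(2\theta)}\,u'(\theta)=\lambda\,\bigl(u(\theta)^5-u(\theta)\bigr),\quad u>0\ \text{ on }(0,\theta_1),\qquad u'(0)=0,\qquad u(\theta_1)=0$$ has at least $2k$ solutions $u$ with initial value $u(0)$ in the interval $(0,1)$.
   Context: Solutions are understood in the classical sense on $[0,\theta_1]$. *)

theory Defs
  imports "HOL-Analysis.Analysis"
begin

(* u is a classical, i.e. C^2([0, b]), solution: v and w are its first and second
   derivatives, one-sided at the end points. The equation is imposed on the open interval,
   as its coefficient is singular at 0; for b < pi/2 continuity extends it to b.
   Extensionality makes equality of HOL functions agree with equality on [0, b], so that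
   solutions differing only outside [0, b] are not counted separately. *)
definition classical_solution :: "real \<Rightarrow> real \<Rightarrow> (real \<Rightarrow> real) \<Rightarrow> bool" where
  "classical_solution lam b u \<longleftrightarrow>
     u \<in> extensional {0..b} \<and>
     (\<exists>v w.
        (\<forall>t\<in>{0..b}. (u has_real_derivative v t) (at t within {0..b})) \<and>
        (\<forall>t\<in>{0..b}. (v has_real_derivative w t) (at t within {0..b})) \<and>
        continuous_on {0..b} w \<and>
        (\<forall>t\<in>{0<..<b}. w t + 2 * (cos (2 * t) / sin (2 * t)) * v t = lam * (u t ^ 5 - u t)) \<and>
        (\<forall>t\<in>{0<..<b}. u t > 0) \<and>
        v 0 = 0 \<and>
        u b = 0)"

end

(* Put mu = -lambda and shoot from theta = 0: u(0) = a, u'(0) = 0. The energy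
   u'^2/2 + mu (u^6/6 - u^2/2) decreases up to pi/4 and increases afterwards. Follow the polar
   angle phi(a, theta) of (1 - u, u'), which depends continuously on a. It passes the values
   where u = 1 only upwards, so it counts the crossings of u = 1.
   For large mu an interval without crossings forces u to be of order 1/mu at its midpoint.
   Hence a = 1/2 produces more than 2k crossings, while small a produces none; so for each
   j = 1, ..., k some a_j has its 2j-th crossing exactly at a point theta_0 between pi/4 and
   theta_1. As there are only 2j crossings, u is tiny somewhere between pi/4 and theta_0, where
   its energy is almost nonnegative; returning to u = 1 then gains energy of order sqrt mu, and
   u falls below 0 before theta_1. Moving a away from a_j in either direction, phi(a, theta_1)
   must leave the interval of length pi around 2 pi j, and u(theta_1) = 1 when it does;
   on the way there u(theta_1) vanishes. This gives two solutions for each j, and solutions for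
   different j are told apart by phi. *)
theory Submission
  imports Defs "HOL-Real_Asymp.Real_Asymp"
begin

section \<open>The singular initial value problem\<close>

text \<open>The coefficient \<open>2 cos(2t)/sin(2t)\<close> blows up at 0. In flux form the
  equation reads \<open>(sin(2t) u')' = \<mu> sin(2t) (u - u^5)\<close>; the quotients
  \<open>sin(2r)/sin(2s)\<close> with \<open>r <= s\<close> stay bounded on \<open>[0, b]\<close>,
  so two integrations leave no singularity. The damping changes sign at pi/4, so monotonicity of the
  energy gives bounds in one direction only on each side. Its companion
  \<open>sin(2t)^2 (energy + \<mu>/3)\<close> has the opposite monotonicity: it caps
  \<open>u\<close> after pi/4, and before pi/4 it keeps orbits off the rest point
  \<open>(1, 0)\<close>, around which the angle is measured. A passage at height O(1/\<mu>) leaves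
  an energy deficit of order \<mu> (1/\<mu>)^2 = 1/\<mu>, whereas a climb from 1/4 to 1 at speed of
  order sqrt \<mu> gains order sqrt \<mu>. The energy at theta_0 is therefore positive, and since
  the potential is nonpositive on u <= 1, the speed of the descent stays bounded away from 0. This
  is where theta_1 > pi/4 enters: energy is gained only beyond pi/4, and theta_0 < theta_1 leaves
  room for the fall.\<close>

lemma joint_continuity_from_lipschitz:
  fixes f :: "real \<Rightarrow> real \<Rightarrow> real"
  assumes lip: "\<And>a a' t. t \<in> T \<Longrightarrow> \<bar>f a t - f a' t\<bar> \<le> C * \<bar>a - a'\<bar>"
    and cont: "\<And>a. continuous_on T (f a)"
  shows "continuous_on (UNIV \<times> T) (\<lambda>(a, t). f a t)"
proof (rule continuous_on_eq_continuous_within[THEN iffD2], intro ballI)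
  fix z assume z: "z \<in> (UNIV::real set) \<times> T"
  obtain a t where zat: "z = (a, t)" and t: "t \<in> T" using z by auto
  have "((\<lambda>w. C * \<bar>fst w - a\<bar>) \<longlongrightarrow> C * \<bar>a - a\<bar>) (at z within UNIV \<times> T)"
    unfolding zat by (intro tendsto_intros) (auto intro!: tendsto_eq_intros)
  then have l1: "((\<lambda>w. C * \<bar>fst w - a\<bar>) \<longlongrightarrow> 0) (at z within UNIV \<times> T)" by simp
  have c2: "continuous_on (UNIV \<times> T) (\<lambda>w. f a (snd w))"
    by (rule continuous_on_compose2[OF cont[of a]]) (auto intro!: continuous_intros)
  then have l2: "((\<lambda>w. f a (snd w)) \<longlongrightarrow> f a t) (at z within UNIV \<times> T)"
    using z by (auto simp: continuous_on zat)
  have l3: "((\<lambda>w. f (fst w) (snd w) - f a (snd w)) \<longlongrightarrow> 0) (at z within UNIV \<times> T)"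
    by (rule Lim_null_comparison[OF _ l1])
      (auto simp: eventually_at_filter lip intro!: always_eventually)
  have "((\<lambda>w. f (fst w) (snd w)) \<longlongrightarrow> f a t) (at z within UNIV \<times> T)"
    using tendsto_add[OF l3 l2] by simp
  then show "continuous (at z within UNIV \<times> T) (\<lambda>(a, t). f a t)"
    by (simp add: continuous_within zat case_prod_beta')
qed

text \<open>This is \<open>u'\<close> recovered from its flux:
  \<open>(sin(2t) u')' = sin(2t) g\<close> with \<open>u'(0) = 0\<close> gives
  \<open>u' = sine_mean g\<close>. At \<open>s = 0\<close> division by zero returns 0, which is both
  the initial value and the limit.\<close>

definition sine_mean :: "(real \<Rightarrow> real) \<Rightarrow> real \<Rightarrow> real" where
  "sine_mean g s = integral {0..s} (\<lambda>r. sin (2 * r) * g r) / sin (2 * s)"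

locale cap =
  fixes b :: real
  assumes b: "pi / 4 < b" "b < pi / 2"
begin

lemma sin_double_pos: "0 < t \<Longrightarrow> t \<le> b \<Longrightarrow> 0 < sin (2 * t)"
  using b by (intro sin_gt_zero) auto

text \<open>\<open>sin(2t)\<close> increases up to pi/4 and afterwards stays above
  \<open>sin(2b)\<close>. Divided out, the kernel \<open>sin(2r)/sin(2s)\<close> is at most
  \<open>1/sin(2b)\<close>, uniformly down to 0.\<close>

lemma sin_double_ge_mult:
  assumes "0 \<le> r" "r \<le> s" "s \<le> b"
  shows "sin (2 * b) * sin (2 * r) \<le> sin (2 * s)"
proof (cases "s \<le> pi / 4")
  case True
  have "sin (2 * r) \<le> sin (2 * s)"
    using assms True by (intro sin_monotone_2pi_le) auto
  moreover have "0 \<le> sin (2 * r)" using assms b by (intro sin_ge_zero) auto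
  moreover from this have "sin (2 * b) * sin (2 * r) \<le> 1 * sin (2 * r)"
    by (intro mult_right_mono) auto
  ultimately show ?thesis by linarith
next
  case False
  have "sin (2 * b) \<le> sin (2 * s)"
  proof -
    have "sin (pi - 2 * b) \<le> sin (pi - 2 * s)"
      using assms False b by (intro sin_monotone_2pi_le) auto
    then show ?thesis by simp
  qed
  moreover have "0 \<le> sin (2 * r)" using assms b by (intro sin_ge_zero) auto
  moreover have "sin (2 * b) > 0" using b sin_double_pos[of b] pi_gt_zero by linarith
  moreover from this have "sin (2 * b) * sin (2 * r) \<le> sin (2 * b) * 1"
    by (intro mult_left_mono) auto
  ultimately show ?thesis by linarith
qed

lemma sine_mean_bound:
  assumes g: "continuous_on {0..b} g" and G: "continuous_on {0..b} G"
    and le: "\<And>r. r \<in> {0..b} \<Longrightarrow> \<bar>g r\<bar> \<le> G r" and s: "s \<in> {0..b}"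
  shows "\<bar>sine_mean g s\<bar> \<le> integral {0..s} G / sin (2 * b)"
proof (cases "s = 0")
  case True
  then show ?thesis by (simp add: sine_mean_def)
next
  case False
  then have p: "sin (2 * s) > 0" "sin (2 * b) > 0" using s b by (auto intro: sin_double_pos)
  have int: "(\<lambda>r. sin (2 * r) * g r) integrable_on {0..s}" "G integrable_on {0..s}"
    using s by (auto intro!: integrable_continuous_real continuous_intros
        continuous_on_subset[OF g] continuous_on_subset[OF G])
  have "\<bar>integral {0..s} (\<lambda>r. sin (2 * r) * g r)\<bar> \<le> integral {0..s} (\<lambda>r. sin (2 * s) / sin (2 * b) * G r)"
    unfolding real_norm_def[symmetric]
  proof (rule integral_norm_bound_integral[OF int(1)])
    show "(\<lambda>r. sin (2 * s) / sin (2 * b) * G r) integrable_on {0..s}"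
      using int(2) by (rule integrable_on_mult_right)
    fix r assume r: "r \<in> {0..s}"
    have "sin (2 * r) \<le> sin (2 * s) / sin (2 * b)"
      using sin_double_ge_mult[of r s] r s p by (simp add: field_simps)
    moreover have "0 \<le> sin (2 * r)" using r s b by (intro sin_ge_zero) auto
    moreover have "\<bar>g r\<bar> \<le> G r" using le[of r] r s by auto
    ultimately have "\<bar>sin (2 * r)\<bar> * \<bar>g r\<bar> \<le> sin (2 * s) / sin (2 * b) * G r"
      by (intro mult_mono) auto
    then show "norm (sin (2 * r) * g r) \<le> sin (2 * s) / sin (2 * b) * G r"
      by (simp add: abs_mult)
  qed
  also have "\<dots> = sin (2 * s) * (integral {0..s} G / sin (2 * b))" by simp
  finally show ?thesis
    unfolding sine_mean_def abs_divide using p(1) by (simp only: abs_of_pos pos_divide_le_eq mult.commute)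
qed

lemma sine_mean_diff:
  assumes "continuous_on {0..b} g1" "continuous_on {0..b} g2" "s \<in> {0..b}"
  shows "sine_mean g1 s - sine_mean g2 s = sine_mean (\<lambda>r. g1 r - g2 r) s"
proof -
  have "(\<lambda>r. sin (2 * r) * g1 r) integrable_on {0..s}" "(\<lambda>r. sin (2 * r) * g2 r) integrable_on {0..s}"
    using assms(3) by (auto intro!: integrable_continuous_real continuous_intros
        continuous_on_subset[OF assms(1)] continuous_on_subset[OF assms(2)])
  from integral_diff[OF this] show ?thesis
    by (simp add: sine_mean_def diff_divide_distrib right_diff_distrib)
qed

text \<open>Only 0 is delicate: there \<open>sine_mean_bound\<close> with a constant majorant
  \<open>D\<close> squeezes the mean below \<open>s D / sin(2b)\<close>.\<close>

lemma continuous_on_sine_mean: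
  assumes g: "continuous_on {0..b} g"
  shows "continuous_on {0..b} (sine_mean g)"
proof -
  have c: "continuous_on {0..b} (\<lambda>s. integral {0..s} (\<lambda>r. sin (2 * r) * g r))"
    by (rule indefinite_integral_continuous_1) (intro integrable_continuous_real continuous_intros g)
  have "\<exists>D. \<forall>r\<in>{0..b}. \<bar>g r\<bar> \<le> D"
    using compact_imp_bounded[OF compact_continuous_image[OF g compact_Icc]]
    by (simp add: bounded_iff)
  then obtain D where D: "\<And>r. r \<in> {0..b} \<Longrightarrow> \<bar>g r\<bar> \<le> D" by blast
  have lim0: "(sine_mean g \<longlongrightarrow> 0) (at 0 within {0..b})"
  proof (rule Lim_null_comparison)
    show "\<forall>\<^sub>F s in at 0 within {0..b}. norm (sine_mean g s) \<le> s * D / sin (2 * b)"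
      using sine_mean_bound[OF g, of "\<lambda>_. D"] D by (auto simp: eventually_at_filter)
    show "((\<lambda>s. s * D / sin (2 * b)) \<longlongrightarrow> 0) (at 0 within {0..b})"
      using b sin_double_pos[of b] pi_gt_zero by (auto intro!: tendsto_eq_intros)
  qed
  have "continuous (at s within {0..b}) (sine_mean g)" if s: "s \<in> {0..b}" for s
  proof (cases "s = 0")
    case True
    then show ?thesis using lim0 by (simp add: continuous_within sine_mean_def)
  next
    case False
    then show ?thesis unfolding sine_mean_def[abs_def]
      using s c sin_double_pos[of s]
      by (intro continuous_intros) (auto simp: continuous_on_eq_continuous_within)
  qed
  then show ?thesis by (simp add: continuous_on_eq_continuous_within)
qed

text \<open>Integrating the equation twice turns the singular initial value problem into a fixed point
  problem. In the weighted norm \<open>sup |u t| exp (- K t)\<close> the integral operator has Lipschitz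
  constant \<open>L / (K\<^sup>2 sin (2 b))\<close>, so large \<open>K\<close> makes it a contraction on all of \<open>[0, b]\<close>.\<close>
lemma singular_ivp:
  fixes h :: "real \<Rightarrow> real"
  assumes lip: "\<And>x y. \<bar>h x - h y\<bar> \<le> L * \<bar>x - y\<bar>" and h0: "h 0 = 0"
  obtains U V :: "real \<Rightarrow> real \<Rightarrow> real" where
    "\<And>a. U a 0 = a" "\<And>a. V a 0 = 0" "\<And>t. t \<in> {0..b} \<Longrightarrow> U 0 t = 0"
    "\<And>a t. t \<in> {0..b} \<Longrightarrow> (U a has_real_derivative V a t) (at t within {0..b})"
    "\<And>a t. t \<in> {0..b} \<Longrightarrow> ((\<lambda>s. sin (2 * s) * V a s) has_real_derivative
        sin (2 * t) * h (U a t)) (at t within {0..b})"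
    "continuous_on (UNIV \<times> {0..b}) (\<lambda>(a, t). U a t)"
    "continuous_on (UNIV \<times> {0..b}) (\<lambda>(a, t). V a t)"
proof -
  have b0: "0 < b" using b pi_gt_zero by linarith
  define p0 where "p0 = sin (2 * b)"
  have p0: "0 < p0" unfolding p0_def using b0 by (intro sin_double_pos) auto
  have L0: "0 \<le> L" using lip[of 1 0] by simp
  \<comment> \<open>Chosen so that \<open>L / (p0 K^2) <= 1/2\<close>; the summand 1 keeps
    \<open>K\<close> positive when \<open>L = 0\<close>.\<close>
  define K where "K = sqrt (2 * (L + 1) / p0)"
  have K0: "K > 0" using L0 p0 by (simp add: K_def)
  have K2: "K * K = 2 * (L + 1) / p0" using L0 p0 by (simp add: K_def)
  have KL: "L / (p0 * (K * K)) \<le> 1 / 2" 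
  proof -
    have "p0 * (K * K) = 2 * (L + 1)" unfolding K2 using p0 by simp
    then show ?thesis using L0 by (simp add: divide_simps)
  qed
  have hcont: "continuous_on X h" for X
    by (rule continuous_on_subset[of UNIV], rule lipschitz_on_continuous_on[of L])
      (auto simp: lipschitz_on_def dist_real_def lip L0)
  \<comment> \<open>The unknown \<open>y\<close> is the solution times \<open>exp (- K t)\<close>,
    which turns the weighted norm into the ordinary distance of bounded continuous functions;
    \<open>W y\<close> removes the weight.\<close>
  define W where "W y t = exp (K * t) * apply_bcontfun y t" for y :: "real \<Rightarrow>\<^sub>C real" and t :: real
  define D where "D y = sine_mean (\<lambda>t. h (W y t))" for y
  define N where "N a y t = exp (- K * t) * (a + integral {0..t} (D y))" for a y t
  \<comment> \<open>Clamping the argument to \<open>[0, b]\<close> extends the image to a bounded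
    continuous function on the whole line, so that Banach's theorem applies in the complete space of
    such functions.\<close>
  define T where "T a y = Bcontfun (\<lambda>x. N a y (max 0 (min b x)))" for a y
  have Wcont: "continuous_on X (W y)" for X y
    unfolding W_def by (intro continuous_intros) auto
  have hWcont: "continuous_on X (\<lambda>t. h (W y t))" for X y
    by (rule continuous_on_compose2[OF hcont[of UNIV] Wcont]) auto
  have Dcont: "continuous_on {0..b} (D y)" for y
    unfolding D_def by (rule continuous_on_sine_mean[OF hWcont])
  have Ncont: "continuous_on {0..b} (N a y)" for a y
    unfolding N_def
    by (intro continuous_intros indefinite_integral_continuous_1 integrable_continuous_real Dcont)
  have Tin: "(\<lambda>x. N a y (max 0 (min b x))) \<in> bcontfun" for a y
  proof -
    have "continuous_on UNIV (\<lambda>x. N a y (max 0 (min b x)))"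
      by (rule continuous_on_compose2[OF Ncont]) (use b0 in \<open>auto intro!: continuous_intros\<close>)
    moreover have "range (\<lambda>x. N a y (max 0 (min b x))) \<subseteq> N a y ` {0..b}" using b0 by auto
    ultimately show ?thesis
      using bounded_subset[OF compact_imp_bounded[OF compact_continuous_image[OF Ncont compact_Icc]]]
      by (simp add: bcontfun_def)
  qed
  have Tapp: "apply_bcontfun (T a y) x = N a y (max 0 (min b x))" for a y x
    unfolding T_def using Tin by (simp add: Bcontfun_inverse)
  \<comment> \<open>Each integration of \<open>exp (K r)\<close> costs a factor \<open>1/K\<close>;
    the two integrations produce the \<open>1/K^2\<close> of the contraction constant.\<close>
  have expint: "integral {0..s} (\<lambda>r. c * exp (K * r)) \<le> c / K * exp (K * s)" if "0 \<le> s" "0 \<le> c" for s c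
  proof -
    have "((\<lambda>r. c * exp (K * r)) has_integral (c / K * exp (K * s) - c / K * exp (K * 0))) {0..s}"
      using that K0 by (intro fundamental_theorem_of_calculus)
        (auto intro!: derivative_eq_intros simp: has_real_derivative_iff_has_vector_derivative[symmetric])
    then show ?thesis
      by (subst integral_unique, assumption) (use that K0 in simp)
  qed
  have Wdiff: "\<bar>W y1 r - W y2 r\<bar> \<le> dist y1 y2 * exp (K * r)" for y1 y2 r
  proof -
    have "W y1 r - W y2 r = (apply_bcontfun y1 r - apply_bcontfun y2 r) * exp (K * r)"
      by (simp add: W_def algebra_simps)
    then have "\<bar>W y1 r - W y2 r\<bar> = \<bar>apply_bcontfun y1 r - apply_bcontfun y2 r\<bar> * exp (K * r)"
      by (simp add: abs_mult)
    also have "\<dots> \<le> dist y1 y2 * exp (K * r)"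
      using dist_bounded[of y1 r y2] by (intro mult_right_mono) (simp_all add: dist_real_def)
    finally show ?thesis .
  qed
  have Ddiff: "\<bar>D y1 s - D y2 s\<bar> \<le> (L * dist y1 y2 / (p0 * K)) * exp (K * s)" if s: "s \<in> {0..b}" for y1 y2 s
  proof -
    have "\<bar>D y1 s - D y2 s\<bar> \<le> integral {0..s} (\<lambda>r. L * dist y1 y2 * exp (K * r)) / sin (2 * b)"
      unfolding D_def sine_mean_diff[OF hWcont hWcont s]
    proof (rule sine_mean_bound[OF _ _ _ s])
      fix r
      have "\<bar>h (W y1 r) - h (W y2 r)\<bar> \<le> L * \<bar>W y1 r - W y2 r\<bar>" by (rule lip)
      also have "\<dots> \<le> L * (dist y1 y2 * exp (K * r))" by (intro mult_left_mono Wdiff L0)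
      finally show "\<bar>h (W y1 r) - h (W y2 r)\<bar> \<le> L * dist y1 y2 * exp (K * r)" by simp
    qed (intro continuous_intros hWcont)+
    also have "\<dots> \<le> (L * dist y1 y2 / K * exp (K * s)) / p0"
      unfolding p0_def[symmetric] using s p0 L0 by (intro divide_right_mono expint) auto
    finally show ?thesis by (simp add: mult.commute)
  qed
  \<comment> \<open>Letting \<open>a\<close> vary as well makes one inequality serve three ends:
    contraction for fixed \<open>a\<close>, Lipschitz dependence of the fixed point on
    \<open>a\<close>, and \<open>Y 0 = 0\<close>.\<close>
  have Tdiff: "dist (T a y1) (T a' y2) \<le> \<bar>a - a'\<bar> + 1 / 2 * dist y1 y2" for a a' y1 y2
  proof (rule dist_bound)
    fix x :: real
    define t where "t = max 0 (min b x)"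
    have t: "t \<in> {0..b}" using b0 by (auto simp: t_def)
    have Dint: "D y integrable_on {0..t}" for y
      using t by (intro integrable_continuous_real continuous_on_subset[OF Dcont]) auto
    have "\<bar>integral {0..t} (\<lambda>s. D y1 s - D y2 s)\<bar> \<le> integral {0..t} (\<lambda>s. (L * dist y1 y2 / (p0 * K)) * exp (K * s))"
      unfolding real_norm_def[symmetric]
    proof (rule integral_norm_bound_integral)
      show "(\<lambda>s. D y1 s - D y2 s) integrable_on {0..t}" by (intro integrable_diff Dint)
      show "(\<lambda>s. L * dist y1 y2 / (p0 * K) * exp (K * s)) integrable_on {0..t}"
        by (intro integrable_continuous_real continuous_intros)
    qed (use Ddiff t in auto)
    also have "\<dots> \<le> L * dist y1 y2 / (p0 * K) / K * exp (K * t)"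
      using t L0 p0 K0 by (intro expint) auto
    also have "\<dots> = L / (p0 * (K * K)) * (dist y1 y2 * exp (K * t))" by simp
    also have "\<dots> \<le> 1 / 2 * (dist y1 y2 * exp (K * t))"
      by (rule mult_right_mono[OF KL]) simp
    finally have I: "\<bar>integral {0..t} (D y1) - integral {0..t} (D y2)\<bar> \<le> 1 / 2 * (dist y1 y2 * exp (K * t))"
      by (simp add: integral_diff[OF Dint Dint])
    have e: "exp (- (K * t)) * exp (K * t) = 1" by (simp add: exp_minus)
    have e1: "exp (- (K * t)) \<le> 1" using K0 t by simp
    have "\<bar>N a y1 t - N a' y2 t\<bar> = exp (- (K * t)) * \<bar>(a - a') + (integral {0..t} (D y1) - integral {0..t} (D y2))\<bar>"
    proof -
      have "N a y1 t - N a' y2 t = exp (- (K * t)) * ((a - a') + (integral {0..t} (D y1) - integral {0..t} (D y2)))"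
        by (simp add: N_def algebra_simps)
      then show ?thesis by (simp add: abs_mult)
    qed
    also have "\<dots> \<le> exp (- (K * t)) * (\<bar>a - a'\<bar> + 1 / 2 * (dist y1 y2 * exp (K * t)))"
    proof (rule mult_left_mono)
      show "\<bar>(a - a') + (integral {0..t} (D y1) - integral {0..t} (D y2))\<bar>
          \<le> \<bar>a - a'\<bar> + 1 / 2 * (dist y1 y2 * exp (K * t))"
        using I by linarith
    qed simp
    also have "\<dots> = exp (- (K * t)) * \<bar>a - a'\<bar> + 1 / 2 * dist y1 y2 * (exp (- (K * t)) * exp (K * t))"
      by (simp add: algebra_simps)
    also have "\<dots> \<le> \<bar>a - a'\<bar> + 1 / 2 * dist y1 y2"
      unfolding e using mult_right_mono[OF e1, of "\<bar>a - a'\<bar>"] by simp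
    finally show "dist (apply_bcontfun (T a y1) x) (apply_bcontfun (T a' y2) x) \<le> \<bar>a - a'\<bar> + 1 / 2 * dist y1 y2"
      unfolding Tapp t_def[symmetric] dist_real_def .
  qed
  have "\<exists>y. T a y = y" for a
  proof -
    have "\<exists>!y. T a y = y"
      by (rule banach_fix_type[of "1 / 2"]) (use Tdiff[of a _ a] in auto)
    then show ?thesis by auto
  qed
  then obtain Y where Y: "\<And>a. T a (Y a) = Y a" by metis
  have Ydiff: "dist (Y a) (Y a') \<le> 2 * \<bar>a - a'\<bar>" for a a'
    using Tdiff[of a "Y a" a' "Y a'"] by (simp add: Y)
  have Y0: "Y 0 = 0"
  proof -
    have "T 0 0 = 0"
    proof (rule bcontfun_eqI)
      fix x
      have "W 0 t = 0" for t by (simp add: W_def)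
      then have "D 0 = (\<lambda>s. 0)" by (auto simp: D_def sine_mean_def h0)
      then show "apply_bcontfun (T 0 0) x = apply_bcontfun 0 x" by (simp add: Tapp N_def)
    qed
    then show ?thesis using Tdiff[of 0 "Y 0" 0 0] by (simp add: Y)
  qed
  define U where "U a = W (Y a)" for a
  define V where "V a = D (Y a)" for a
  have Ueq: "U a t = a + integral {0..t} (V a)" if t: "t \<in> {0..b}" for a t
  proof -
    have "apply_bcontfun (Y a) t = N a (Y a) t"
    proof -
      have "max 0 (min b t) = t" using t by auto
      then show ?thesis using Tapp[of a "Y a" t] by (simp add: Y)
    qed
    then have "U a t = (exp (K * t) * exp (- (K * t))) * (a + integral {0..t} (V a))"
      by (simp add: U_def W_def N_def V_def)
    then show ?thesis by (simp add: exp_minus)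
  qed
  have Vcont: "continuous_on {0..b} (V a)" for a unfolding V_def by (rule Dcont)
  show thesis
  proof
    show "U a 0 = a" for a using Ueq[of 0 a] b0 by simp
    show "V a 0 = 0" for a by (simp add: V_def D_def sine_mean_def)
    show "U 0 t = 0" for t by (simp add: U_def Y0 W_def)
    show "(U a has_real_derivative V a t) (at t within {0..b})" if t: "t \<in> {0..b}" for a t
    proof -
      have "((\<lambda>t. a + integral {0..t} (V a)) has_real_derivative 0 + V a t) (at t within {0..b})"
        by (intro DERIV_add DERIV_const integral_has_real_derivative Vcont t)
      then have "((\<lambda>t. a + integral {0..t} (V a)) has_real_derivative V a t) (at t within {0..b})"
        by simp
      then show ?thesis
        by (rule has_field_derivative_transform_within[of _ _ _ _ 1]) (use t Ueq in auto)
    qed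
    show "((\<lambda>s. sin (2 * s) * V a s) has_real_derivative sin (2 * t) * h (U a t)) (at t within {0..b})"
      if t: "t \<in> {0..b}" for a t
    proof -
      have "((\<lambda>t. integral {0..t} (\<lambda>r. sin (2 * r) * h (U a r))) has_real_derivative
          sin (2 * t) * h (U a t)) (at t within {0..b})"
        by (rule integral_has_real_derivative[OF _ t]) (use hWcont in \<open>auto intro!: continuous_intros simp: U_def\<close>)
      then show ?thesis
      proof (rule has_field_derivative_transform_within[of _ _ _ _ 1])
        fix s assume s: "s \<in> {0..b}"
        show "integral {0..s} (\<lambda>r. sin (2 * r) * h (U a r)) = sin (2 * s) * V a s"
          using sin_double_pos[of s] s by (cases "s = 0") (auto simp: V_def D_def U_def sine_mean_def)
      qed (use t in auto)
    qed
    have Ulip: "\<bar>U a t - U a' t\<bar> \<le> (2 * exp (K * b)) * \<bar>a - a'\<bar>" if t: "t \<in> {0..b}" for a a' t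
    proof -
      have "\<bar>U a t - U a' t\<bar> \<le> dist (Y a) (Y a') * exp (K * t)" unfolding U_def by (rule Wdiff)
      also have "\<dots> \<le> (2 * \<bar>a - a'\<bar>) * exp (K * b)"
        using t K0 by (intro mult_mono Ydiff) auto
      finally show ?thesis by (simp add: mult_ac)
    qed
    show "continuous_on (UNIV \<times> {0..b}) (\<lambda>(a, t). U a t)"
      by (rule joint_continuity_from_lipschitz[OF Ulip]) (auto simp: U_def Wcont)
    have Vlip: "\<bar>V a t - V a' t\<bar> \<le> (L * 2 / (p0 * K) * exp (K * b)) * \<bar>a - a'\<bar>" if t: "t \<in> {0..b}" for a a' t
    proof -
      have "\<bar>V a t - V a' t\<bar> \<le> L * dist (Y a) (Y a') / (p0 * K) * exp (K * t)"
        unfolding V_def by (rule Ddiff[OF t])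
      also have "\<dots> \<le> L * (2 * \<bar>a - a'\<bar>) / (p0 * K) * exp (K * b)"
        using t K0 p0 L0 by (intro mult_mono divide_right_mono mult_left_mono Ydiff) auto
      finally show ?thesis by (simp add: mult_ac)
    qed
    show "continuous_on (UNIV \<times> {0..b}) (\<lambda>(a, t). V a t)"
      by (rule joint_continuity_from_lipschitz[OF Vlip]) (auto simp: Vcont)
  qed
qed

end

section \<open>Excursions between crossings\<close>

lemma first_hit:
  fixes f :: "real \<Rightarrow> real"
  assumes "c \<le> d" "continuous_on {c..d} f" "f c \<le> y" "y \<le> f d"
  obtains t where "c \<le> t" "t \<le> d" "f t = y" "\<And>r. c \<le> r \<Longrightarrow> r < t \<Longrightarrow> f r < y"
proof -
  define A where "A = {c..d} \<inter> f -` {y}"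
  have Aclosed: "closed A" unfolding A_def by (rule continuous_closed_preimage[OF assms(2)]) auto
  have "A \<noteq> {}" using IVT'[of f c y d] assms unfolding A_def by auto
  moreover have bdd: "bdd_below A" by (auto simp: A_def)
  ultimately have tA: "Inf A \<in> A" using closed_contains_Inf[OF _ _ Aclosed] by blast
  define t where "t = Inf A"
  have t: "c \<le> t" "t \<le> d" "f t = y" using tA by (auto simp: A_def t_def)
  have "f r < y" if r: "c \<le> r" "r < t" for r
  proof (rule ccontr)
    assume ge: "\<not> f r < y"
    have "continuous_on {c..r} f" using r t by (intro continuous_on_subset[OF assms(2)]) auto
    then obtain w where w: "c \<le> w" "w \<le> r" "f w = y"
      using IVT'[of f c y r] r ge assms by auto
    then have "t \<le> w" unfolding t_def
      using r t by (intro cInf_lower bdd) (auto simp: A_def)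
    then show False using w r by simp
  qed
  then show thesis using t that by blast
qed

lemma last_hit:
  fixes f :: "real \<Rightarrow> real"
  assumes "c \<le> d" "continuous_on {c..d} f" "f c \<le> y" "y \<le> f d"
  obtains t where "c \<le> t" "t \<le> d" "f t = y" "\<And>r. t < r \<Longrightarrow> r \<le> d \<Longrightarrow> y < f r"
proof -
  have "continuous_on {- d..- c} (\<lambda>x. - f (- x))"
    by (intro continuous_intros continuous_on_compose2[OF assms(2)]) auto
  then obtain t where t: "- d \<le> t" "t \<le> - c" "- f (- t) = - y"
      "\<And>r. - d \<le> r \<Longrightarrow> r < t \<Longrightarrow> - f (- r) < - y"
    using first_hit[of "- d" "- c" "\<lambda>x. - f (- x)" "- y"] assms by auto
  show thesis
    by (rule that[of "- t"]) (use t(1-3) t(4)[of "- r" for r] in auto)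
qed

text \<open>The flux \<open>p z\<close> of \<open>y\<close> starts nonpositive and loses at least
  \<open>\<kappa> (d - c)\<close> on \<open>[c, d]\<close>. Since \<open>z <= 0\<close> and
  \<open>p <= 1\<close>, the slope satisfies \<open>z <= p z\<close>, so this loss bounds the slope
  on \<open>[d, t]\<close> and is integrated once more.\<close>

lemma flux_descent:
  fixes y z p q :: "real \<Rightarrow> real"
  assumes le: "c \<le> d" "d \<le> t" and \<kappa>: "0 \<le> \<kappa>"
    and y: "\<And>x. x \<in> {c..t} \<Longrightarrow> (y has_real_derivative z x) (at x within {c..t})"
    and P: "\<And>x. x \<in> {c..t} \<Longrightarrow> ((\<lambda>x. p x * z x) has_real_derivative q x) (at x within {c..t})"
    and p: "\<And>x. x \<in> {c..t} \<Longrightarrow> 0 < p x \<and> p x \<le> 1"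
    and zc: "z c \<le> 0"
    and q1: "\<And>x. x \<in> {c..d} \<Longrightarrow> q x \<le> - \<kappa>" and q2: "\<And>x. x \<in> {c..t} \<Longrightarrow> q x \<le> 0"
  shows "y t \<le> y d - \<kappa> * (d - c) * (t - d)" "\<And>x. x \<in> {c..t} \<Longrightarrow> z x \<le> 0"
proof -
  have PD: "((\<lambda>x. p x * z x) has_real_derivative q x) (at x)" if "c < x" "x < t" for x
    using P[of x] that by (simp add: at_within_Icc_at)
  have yD: "(y has_real_derivative z x) (at x)" if "c < x" "x < t" for x
    using y[of x] that by (simp add: at_within_Icc_at)
  have Pc: "continuous_on {c..t} (\<lambda>x. p x * z x)" by (rule DERIV_continuous_on[OF P])
  have yc: "continuous_on {c..t} y" by (rule DERIV_continuous_on[OF y])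
  have Pcc: "p c * z c \<le> 0" using p[of c] le zc by (simp add: mult_nonneg_nonpos)
  have Pneg: "p x * z x \<le> 0" if x: "x \<in> {c..t}" for x
  proof -
    have "p x * z x \<le> p c * z c"
    proof (rule DERIV_nonpos_imp_decreasing_open[where f = "\<lambda>x. p x * z x"])
      show "\<exists>y. ((\<lambda>x. p x * z x) has_real_derivative y) (at r) \<and> y \<le> 0" if "c < r" "r < x" for r
        using PD[of r] q2[of r] x that by auto
    qed (use x in \<open>auto intro: continuous_on_subset[OF Pc]\<close>)
    then show ?thesis using Pcc by simp
  qed
  show z0: "z x \<le> 0" if "x \<in> {c..t}" for x
    using Pneg[OF that] p[OF that] by (auto simp: mult_le_0_iff)
  have Pd: "p x * z x \<le> - \<kappa> * (d - c)" if x: "x \<in> {d..t}" for x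
  proof -
    have "p x * z x \<le> p d * z d"
    proof (rule DERIV_nonpos_imp_decreasing_open[where f = "\<lambda>x. p x * z x"])
      show "\<exists>y. ((\<lambda>x. p x * z x) has_real_derivative y) (at r) \<and> y \<le> 0" if "d < r" "r < x" for r
        using PD[of r] q2[of r] x le that by auto
    qed (use x le in \<open>auto intro: continuous_on_subset[OF Pc]\<close>)
    moreover have "p d * z d + \<kappa> * d \<le> p c * z c + \<kappa> * c"
    proof (rule DERIV_nonpos_imp_decreasing_open[where f = "\<lambda>x. p x * z x + \<kappa> * x"])
      show "\<exists>y. ((\<lambda>x. p x * z x + \<kappa> * x) has_real_derivative y) (at r) \<and> y \<le> 0" if "c < r" "r < d" for r
        using DERIV_add[OF PD[of r] DERIV_cmult_Id[of \<kappa> r]] q1[of r] le that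
        by (intro exI[of _ "q r + \<kappa>"]) auto
      show "continuous_on {c..d} (\<lambda>x. p x * z x + \<kappa> * x)"
        using le by (intro continuous_intros continuous_on_subset[OF Pc]) auto
    qed (use le in auto)
    ultimately show ?thesis using Pcc by (simp add: algebra_simps)
  qed
  have "y t + \<kappa> * (d - c) * t \<le> y d + \<kappa> * (d - c) * d"
  proof (rule DERIV_nonpos_imp_decreasing_open[where f = "\<lambda>x. y x + \<kappa> * (d - c) * x"])
    fix r assume r: "d < r" "r < t"
    have "0 \<le> (1 - p r) * (- z r)" using p[of r] z0[of r] r le by (intro mult_nonneg_nonneg) auto
    then have "z r \<le> p r * z r" by (simp add: algebra_simps)
    then have "z r + \<kappa> * (d - c) \<le> 0" using Pd[of r] r by simp
    then show "\<exists>y'. ((\<lambda>x. y x + \<kappa> * (d - c) * x) has_real_derivative y') (at r) \<and> y' \<le> 0"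
      using yD[of r] r le by (intro exI[of _ "z r + \<kappa> * (d - c)"]) (auto intro!: derivative_eq_intros)
  next
    show "continuous_on {d..t} (\<lambda>x. y x + \<kappa> * (d - c) * x)"
      using le by (intro continuous_intros continuous_on_subset[OF yc]) auto
  qed (use le in auto)
  then show "y t \<le> y d - \<kappa> * (d - c) * (t - d)" by (simp add: algebra_simps)
qed

text \<open>On the half interval where \<open>u\<close> moves away from its value at \<open>c\<close>: an excursion above 1, or one
  that stays in \<open>[1/2, 1]\<close>, is too concave to last long, and below \<open>1/2\<close> the growth of \<open>u\<close> forces
  \<open>u c\<close> to be tiny.\<close>
lemma half_excursion:
  fixes u z p :: "real \<Rightarrow> real"
  assumes ct: "c < t" and \<mu>: "0 < \<mu>" and p0: "0 < p0"
    and u: "\<And>x. x \<in> {c..t} \<Longrightarrow> (u has_real_derivative z x) (at x within {c..t})"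
    and P: "\<And>x. x \<in> {c..t} \<Longrightarrow>
      ((\<lambda>x. p x * z x) has_real_derivative \<mu> * p x * (u x - u x ^ 5)) (at x within {c..t})"
    and p: "\<And>x. x \<in> {c..t} \<Longrightarrow> p0 \<le> p x \<and> p x \<le> 1"
    and pos: "\<And>x. x \<in> {c..t} \<Longrightarrow> 0 < u x"
  shows "\<lbrakk>\<And>x. x \<in> {c..<t} \<Longrightarrow> 1 < u x; z c \<le> 0\<rbrakk> \<Longrightarrow> \<mu> * p0 * (t - c)\<^sup>2 \<le> 1"
    and "\<lbrakk>\<And>x. x \<in> {c..<t} \<Longrightarrow> u x < 1; 0 \<le> z c; \<mu> * p0 * (t - c)\<^sup>2 > 32\<rbrakk>
      \<Longrightarrow> u c * (\<mu> * p0 * (t - c)\<^sup>2) \<le> 16"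
proof -
  define d where "d = (c + t) / 2"
  have cdt: "c < d" "d < t" using ct by (auto simp: d_def)
  have uc: "continuous_on {c..t} u" by (rule DERIV_continuous_on[OF u])
  have p': "0 < p x \<and> p x \<le> 1" if "x \<in> {c..t}" for x using p[OF that] p0 by auto
  {
    assume gt: "\<And>x. x \<in> {c..<t} \<Longrightarrow> 1 < u x" and zc: "z c \<le> 0"
    have ut: "1 \<le> u t"
      by (rule continuous_ge_on_closure[of "{c..<t}" u])
        (use gt ct uc in \<open>auto simp: closure_atLeastLessThan less_imp_le\<close>)
    have ge: "1 \<le> u x" if "x \<in> {c..t}" for x using gt[of x] ut that by (cases "x = t") auto
    \<comment> \<open>\<open>v^5 - v = (v - 1)(v + v^2 + v^3 + v^4)\<close>, and the second factor
      is at least 4.\<close>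
    have poly: "v - v ^ 5 \<le> - 4 * (v - 1)" if "1 \<le> v" for v :: real
    proof -
      have "1 \<le> v ^ 2" "1 \<le> v ^ 3" "1 \<le> v ^ 4" using that by (rule one_le_power)+
      then have "0 \<le> (v - 1) * (v + v^2 + v^3 + v^4 - 4)"
        using that by (intro mult_nonneg_nonneg) linarith+
      then show ?thesis by (simp add: algebra_simps eval_nat_numeral)
    qed
    have q: "\<mu> * p x * (u x - u x ^ 5) \<le> - (4 * \<mu> * p0 * (u x - 1))" if x: "x \<in> {c..t}" for x
    proof -
      have "p0 * (u x - 1) \<le> p x * (u x - 1)" using p[OF x] ge[OF x] by (intro mult_right_mono) auto
      then have "4 * \<mu> * (p0 * (u x - 1)) \<le> 4 * \<mu> * (p x * (u x - 1))"
        using \<mu> by (intro mult_left_mono) auto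
      moreover have "\<mu> * p x * (u x - u x ^ 5) \<le> \<mu> * p x * (- 4 * (u x - 1))"
        using poly[OF ge[OF x]] \<mu> p'[OF x] by (intro mult_left_mono) auto
      ultimately show ?thesis by (simp add: algebra_simps)
    qed
    have q0: "\<mu> * p x * (u x - u x ^ 5) \<le> 0" if x: "x \<in> {c..t}" for x
    proof -
      have "0 \<le> 4 * \<mu> * p0 * (u x - 1)" using \<mu> p0 ge[OF x] by auto
      then show ?thesis using q[OF x] by linarith
    qed
    have z0: "z x \<le> 0" if "x \<in> {c..t}" for x
      by (rule flux_descent(2)[OF _ _ _ u P p' zc, of c 0]) (use that q0 ct in auto)
    have mono: "u d \<le> u x" if x: "x \<in> {c..d}" for x
    proof (rule DERIV_nonpos_imp_decreasing_open[where f = u])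
      show "\<exists>y. (u has_real_derivative y) (at r) \<and> y \<le> 0" if "x < r" "r < d" for r
        using u[of r] z0[of r] x cdt that by (auto simp: at_within_Icc_at)
    qed (use x cdt in \<open>auto intro: continuous_on_subset[OF uc]\<close>)
    \<comment> \<open>As \<open>u\<close> decreases, \<open>u - 1 >= u d - 1\<close> on the first
      half, which fixes the rate of flux loss. The resulting drop is a multiple of
      \<open>u d - 1\<close>, yet \<open>u\<close> may lose at most \<open>u d - 1\<close> before
      reaching 1; the factor \<open>u d - 1 > 0\<close> cancels.\<close>
    have "u t \<le> u d - 4 * \<mu> * p0 * (u d - 1) * (d - c) * (t - d)"
    proof (rule flux_descent(1)[OF _ _ _ u P p' zc])
      fix x assume x: "x \<in> {c..d}"
      have "4 * \<mu> * p0 * (u d - 1) \<le> 4 * \<mu> * p0 * (u x - 1)"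
        using mono[OF x] \<mu> p0 by (intro mult_left_mono) auto
      then show "\<mu> * p x * (u x - u x ^ 5) \<le> - (4 * \<mu> * p0 * (u d - 1))"
        using q[of x] x cdt by auto
    next
      show "0 \<le> 4 * \<mu> * p0 * (u d - 1)" using \<mu> p0 ge[of d] cdt by auto
    qed (use q0 cdt in auto)
    then have "4 * \<mu> * p0 * (u d - 1) * (d - c) * (t - d) \<le> u d - 1" using ut by linarith
    moreover have "4 * \<mu> * p0 * (u d - 1) * (d - c) * (t - d) = (\<mu> * p0 * (t - c)\<^sup>2) * (u d - 1)"
      unfolding d_def by (simp add: field_simps power2_eq_square)
    ultimately show "\<mu> * p0 * (t - c)\<^sup>2 \<le> 1" using gt[of d] cdt by simp
  }
  {
    assume lt: "\<And>x. x \<in> {c..<t} \<Longrightarrow> u x < 1" and zc: "0 \<le> z c" and big: "\<mu> * p0 * (t - c)\<^sup>2 > 32"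
    have ut: "u t \<le> 1"
      by (rule continuous_le_on_closure[of "{c..<t}" u])
        (use lt ct uc in \<open>auto simp: closure_atLeastLessThan less_imp_le\<close>)
    have le: "u x \<le> 1" if "x \<in> {c..t}" for x using lt[of x] ut that by (cases "x = t") auto
    have q0: "0 \<le> \<mu> * p x * (u x - u x ^ 5)" if x: "x \<in> {c..t}" for x
    proof -
      have "u x ^ 5 \<le> u x ^ 1" using pos[OF x] le[OF x] by (intro power_decreasing) auto
      then show ?thesis using \<mu> p'[OF x] by auto
    qed
    have u': "((\<lambda>x. - u x) has_real_derivative - z x) (at x within {c..t})" if "x \<in> {c..t}" for x
      by (intro DERIV_minus u that)
    have P': "((\<lambda>x. p x * - z x) has_real_derivative - (\<mu> * p x * (u x - u x ^ 5))) (at x within {c..t})"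
      if "x \<in> {c..t}" for x
      using DERIV_minus[OF P[OF that]] by simp
    have z0: "0 \<le> z x" if "x \<in> {c..t}" for x
      using flux_descent(2)[OF _ _ _ u' P' p', of c 0 x] q0 that ct zc by auto
    have mono: "u x \<le> u x'" if x: "x \<in> {c..t}" "x' \<in> {c..t}" "x \<le> x'" for x x'
    proof (rule DERIV_nonneg_imp_increasing_open[where f = u])
      show "\<exists>y. (u has_real_derivative y) (at r) \<and> 0 \<le> y" if "x < r" "r < x'" for r
        using u[of r] z0[of r] x that by (auto simp: at_within_Icc_at)
    qed (use x in \<open>auto intro: continuous_on_subset[OF uc]\<close>)
    \<comment> \<open>Otherwise \<open>1/2 <= u\<close> on all of \<open>[d, t]\<close>. The descent
      estimate for \<open>1 - u\<close> there, with quarter lengths \<open>(t - c)/4\<close> and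
      rate \<open>\<mu> p0 / 2\<close>, gives the factor \<open>(t - c)^2 / 32\<close> that
      contradicts \<open>big\<close>.\<close>
    have ud: "u d \<le> 1 / 2"
    proof (rule ccontr)
      assume "\<not> u d \<le> 1 / 2"
      then have half: "1 / 2 \<le> u x" if "x \<in> {d..t}" for x
        using mono[of d x] that cdt by auto
      have q: "\<mu> * p x * (u x - u x ^ 5) \<ge> \<mu> * p0 / 2 * (1 - u x)" if x: "x \<in> {d..t}" for x
      proof -
        have "(1 - u x) * (1 / 2) \<le> (1 - u x) * (u x * (1 + u x + u x ^ 2 + u x ^ 3))"
        proof (rule mult_left_mono)
          have "1 / 2 * 1 \<le> u x * (1 + u x + u x ^ 2 + u x ^ 3)"
            using half[OF x] by (intro mult_mono) auto
          then show "1 / 2 \<le> u x * (1 + u x + u x ^ 2 + u x ^ 3)" by simp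
        qed (use le[of x] x cdt in auto)
        also have "\<dots> = u x - u x ^ 5" by (simp add: algebra_simps eval_nat_numeral)
        finally have "\<mu> * p x * ((1 - u x) * (1 / 2)) \<le> \<mu> * p x * (u x - u x ^ 5)"
          using \<mu> p'[of x] x cdt by (intro mult_left_mono) auto
        moreover have "\<mu> * p0 * ((1 - u x) * (1 / 2)) \<le> \<mu> * p x * ((1 - u x) * (1 / 2))"
          using \<mu> p[of x] x cdt le[of x] by (intro mult_right_mono mult_left_mono) auto
        moreover have "\<mu> * p0 / 2 * (1 - u x) = \<mu> * p0 * ((1 - u x) * (1 / 2))" by simp
        ultimately show ?thesis by linarith
      qed
      define e where "e = (d + t) / 2"
      have det: "d < e" "e < t" using cdt by (auto simp: e_def)
      have "1 - u t \<le> 1 - u e - \<mu> * p0 / 2 * (1 - u e) * (e - d) * (t - e)"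
      proof (rule flux_descent(1)[where p = p and z = "\<lambda>x. - z x" and c = d])
        show "((\<lambda>x. 1 - u x) has_real_derivative - z x) (at x within {d..t})" if "x \<in> {d..t}" for x
          using u[of x] that cdt
          by (auto intro!: derivative_eq_intros intro: DERIV_subset[of u _ x "{c..t}"])
        show "((\<lambda>x. p x * - z x) has_real_derivative - (\<mu> * p x * (u x - u x ^ 5))) (at x within {d..t})"
          if "x \<in> {d..t}" for x
          using P'[of x] that cdt by (auto intro: DERIV_subset[of _ _ x "{c..t}"])
        fix x assume x: "x \<in> {d..e}"
        have "\<mu> * p0 / 2 * (1 - u e) \<le> \<mu> * p0 / 2 * (1 - u x)"
          using mono[of x e] \<mu> p0 x cdt det by (intro mult_left_mono) auto
        then show "- (\<mu> * p x * (u x - u x ^ 5)) \<le> - (\<mu> * p0 / 2 * (1 - u e))"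
          using q[of x] x det by auto
      qed (use q0 p' z0[of d] cdt det \<mu> p0 le[of e] in auto)
      then have "\<mu> * p0 / 2 * (1 - u e) * (e - d) * (t - e) \<le> 1 - u e" using ut by linarith
      moreover have "\<mu> * p0 / 2 * (1 - u e) * (e - d) * (t - e) = (\<mu> * p0 * (t - c)\<^sup>2 / 32) * (1 - u e)"
        unfolding e_def d_def by (simp add: field_simps power2_eq_square)
      ultimately have "(\<mu> * p0 * (t - c)\<^sup>2 / 32) * (1 - u e) \<le> 1 * (1 - u e)"
        by (simp only: mult_1)
      moreover have "0 < 1 - u e" using lt[of e] cdt det by simp
      ultimately show False using big by (simp only: mult_le_cancel_right_pos)
    qed
    define e where "e = (c + d) / 2"
    have ced: "c < e" "e < d" using cdt by (auto simp: e_def)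
    \<comment> \<open>On \<open>[c, d]\<close> now \<open>u <= 1/2\<close>, hence
      \<open>u - u^5 >= u/2 >= u c / 2\<close>. The descent estimate for \<open>- u\<close> makes
      \<open>u\<close> grow by \<open>u c\<close> times the large factor over 32, while the growth
      is at most 1/2.\<close>
    have "- u d \<le> - u e - \<mu> * p0 / 2 * u c * (e - c) * (d - e)"
    proof (rule flux_descent(1)[where p = p and z = "\<lambda>x. - z x" and c = c])
      show "((\<lambda>x. - u x) has_real_derivative - z x) (at x within {c..d})" if "x \<in> {c..d}" for x
        using u'[of x] that cdt by (auto intro: DERIV_subset[of _ _ x "{c..t}"])
      show "((\<lambda>x. p x * - z x) has_real_derivative - (\<mu> * p x * (u x - u x ^ 5))) (at x within {c..d})"
        if "x \<in> {c..d}" for x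
        using P'[of x] that cdt by (auto intro: DERIV_subset[of _ _ x "{c..t}"])
      fix x assume x: "x \<in> {c..e}"
      have xt: "x \<in> {c..t}" using x ced cdt by auto
      have x2: "u x \<le> 1 / 2" using mono[of x d] ud x ced cdt by auto
      have "u x ^ 4 \<le> (1 / 2) ^ 4" using pos[OF xt] x2 by (intro power_mono) auto
      then have "u x * (1 / 2) \<le> u x * (1 - u x ^ 4)"
        using pos[OF xt] by (intro mult_left_mono) (auto simp: power_one_over)
      also have "\<dots> = u x - u x ^ 5" by (simp add: algebra_simps eval_nat_numeral)
      finally have "u c / 2 \<le> u x - u x ^ 5" using mono[of c x] xt ct by auto
      then have "\<mu> * p x * (u c / 2) \<le> \<mu> * p x * (u x - u x ^ 5)"
        using \<mu> p'[OF xt] by (intro mult_left_mono) auto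
      moreover have "\<mu> * p0 * (u c / 2) \<le> \<mu> * p x * (u c / 2)"
        using \<mu> p[OF xt] pos[of c] ct by (intro mult_right_mono mult_left_mono) auto
      ultimately show "- (\<mu> * p x * (u x - u x ^ 5)) \<le> - (\<mu> * p0 / 2 * u c)" by simp
    qed (use q0 p' zc ced cdt \<mu> p0 pos[of c] in auto)
    moreover have "\<mu> * p0 / 2 * u c * (e - c) * (d - e) = u c * (\<mu> * p0 * (t - c)\<^sup>2) / 32"
      unfolding e_def d_def by (simp add: field_simps power2_eq_square)
    moreover have "0 < u e" using pos[of e] ced cdt by auto
    ultimately show "u c * (\<mu> * p0 * (t - c)\<^sup>2) \<le> 16" using ud by linarith
  }
qed

text \<open>The sign of the slope at the midpoint decides on which half \<open>u\<close> moves away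
  monotonically; the left half is treated after the reflection \<open>x -> - x\<close>. Halving the
  interval divides the squared length by 4, whence 128 = 4 * 32 and 64 = 4 * 16.\<close>

lemma excursion_midpoint_small:
  fixes u z p :: "real \<Rightarrow> real"
  assumes st: "s < t" and \<mu>: "0 < \<mu>" and p0: "0 < p0"
    and u: "\<And>x. x \<in> {s..t} \<Longrightarrow> (u has_real_derivative z x) (at x within {s..t})"
    and P: "\<And>x. x \<in> {s..t} \<Longrightarrow>
      ((\<lambda>x. p x * z x) has_real_derivative \<mu> * p x * (u x - u x ^ 5)) (at x within {s..t})"
    and p: "\<And>x. x \<in> {s..t} \<Longrightarrow> p0 \<le> p x \<and> p x \<le> 1"
    and pos: "\<And>x. x \<in> {s..t} \<Longrightarrow> 0 < u x"
    and ne: "\<And>x. x \<in> {s<..<t} \<Longrightarrow> u x \<noteq> 1"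
    and long: "\<mu> * p0 * (t - s)\<^sup>2 > 128"
  shows "u ((s + t) / 2) * (\<mu> * p0 * (t - s)\<^sup>2) \<le> 64"
proof -
  define c where "c = (s + t) / 2"
  have sct: "s < c" "c < t" using st by (auto simp: c_def)
  have half: "4 * (\<mu> * p0 * (t - c)\<^sup>2) = \<mu> * p0 * (t - s)\<^sup>2" "4 * (\<mu> * p0 * (- s - - c)\<^sup>2) = \<mu> * p0 * (t - s)\<^sup>2"
    unfolding c_def by (simp_all add: field_simps power2_eq_square)
  have uc: "continuous_on {s..t} u" by (rule DERIV_continuous_on[OF u])
  have side: "(\<forall>x\<in>{s<..<t}. 1 < u x) \<or> (\<forall>x\<in>{s<..<t}. u x < 1)"
  proof (rule ccontr)
    assume "\<not> ?thesis"
    then obtain x y where xy: "x \<in> {s<..<t}" "y \<in> {s<..<t}" "u x \<le> 1" "1 \<le> u y"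
      by (auto simp: not_less)
    have "connected (u ` {s<..<t})"
      by (intro connected_continuous_image continuous_on_subset[OF uc]) auto
    then have "1 \<in> u ` {s<..<t}"
      using xy by (meson connectedD_interval imageI)
    then show False using ne by auto
  qed
  have rt: "(u has_real_derivative z x) (at x within {c..t})"
      "((\<lambda>x. p x * z x) has_real_derivative \<mu> * p x * (u x - u x ^ 5)) (at x within {c..t})"
      "p0 \<le> p x \<and> p x \<le> 1" "0 < u x" if "x \<in> {c..t}" for x
    using u[of x] P[of x] p[of x] pos[of x] that sct by (auto intro: DERIV_subset[of _ _ x "{s..t}"])
  have mirror: "(f has_real_derivative D) (at (- x) within {s..t}) \<Longrightarrow> x \<in> {- c..- s} \<Longrightarrow>
      ((\<lambda>x. f (- x)) has_real_derivative - D) (at x within {- c..- s})" for f D x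
  proof -
    assume f: "(f has_real_derivative D) (at (- x) within {s..t})" and x: "x \<in> {- c..- s}"
    have "(f has_real_derivative D) (at (- x) within uminus ` {- c..- s})"
      by (rule DERIV_subset[OF f]) (use sct in auto)
    from DERIV_image_chain[OF this DERIV_minus[OF DERIV_ident]]
    show ?thesis by (simp add: o_def)
  qed
  have lt: "((\<lambda>x. u (- x)) has_real_derivative - z (- x)) (at x within {- c..- s})"
      "((\<lambda>x. p (- x) * - z (- x)) has_real_derivative \<mu> * p (- x) * (u (- x) - u (- x) ^ 5)) (at x within {- c..- s})"
      "p0 \<le> p (- x) \<and> p (- x) \<le> 1" "0 < u (- x)" if x: "x \<in> {- c..- s}" for x
    using mirror[OF u x] DERIV_minus[OF mirror[OF P x]] p[of "- x"] pos[of "- x"] x sct by auto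
  note R = half_excursion[OF sct(2) \<mu> p0 rt]
  have cs: "- c < - s" using sct by simp
  note L = half_excursion[OF cs \<mu> p0 lt]
  have below: "\<forall>x\<in>{s<..<t}. u x < 1"
  proof (rule ccontr)
    assume "\<not> ?thesis"
    then have gt: "\<And>x. x \<in> {s<..<t} \<Longrightarrow> 1 < u x" using side by auto
    show False
    proof (cases "z c \<le> 0")
      case True
      then have "\<mu> * p0 * (t - c)\<^sup>2 \<le> 1" by (intro R(1)) (use gt sct in auto)
      then show False using half long by linarith
    next
      case False
      then have "\<mu> * p0 * (- s - - c)\<^sup>2 \<le> 1" by (intro L(1)) (use gt sct in auto)
      then show False using half long by linarith
    qed
  qed
  show "u ((s + t) / 2) * (\<mu> * p0 * (t - s)\<^sup>2) \<le> 64"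
    unfolding c_def[symmetric]
  proof (cases "0 \<le> z c")
    case True
    then have "u c * (\<mu> * p0 * (t - c)\<^sup>2) \<le> 16"
    proof (intro R(2))
      show "32 < \<mu> * p0 * (t - c)\<^sup>2" using half long by linarith
    qed (use below sct in auto)
    then show "u c * (\<mu> * p0 * (t - s)\<^sup>2) \<le> 64" unfolding half(1)[symmetric] by linarith
  next
    case False
    then have "u (- (- c)) * (\<mu> * p0 * (- s - - c)\<^sup>2) \<le> 16"
    proof (intro L(2))
      show "32 < \<mu> * p0 * (- s - - c)\<^sup>2" using half long by linarith
    qed (use below sct in auto)
    then show "u c * (\<mu> * p0 * (t - s)\<^sup>2) \<le> 64" unfolding half(2)[symmetric] minus_minus by linarith
  qed
qed

section \<open>Energy\<close>

text \<open>The term \<open>u - u\<^sup>5\<close>, truncated to be globally Lipschitz. It vanishes on the negative axis, so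
  that a solution which has reached 0 cannot return; the zeros of \<open>u \<theta>\<^sub>1\<close> are then automatically
  first zeros.\<close>
definition reaction :: "real \<Rightarrow> real \<Rightarrow> real" where
  "reaction M x = max 0 (min M x) - max 0 (min M x) ^ 5"

text \<open>A primitive of minus the reaction term, cut off on the negative side only. At the upper
  end it ignores the truncation, so the energy identities carry the hypothesis
  \<open>U a t \<le> M\<close> until \<open>U_less_M\<close> discharges it.\<close>

definition potential :: "real \<Rightarrow> real" where
  "potential x = max 0 x ^ 6 / 6 - max 0 x ^ 2 / 2"

lemma reaction_lipschitz:
  assumes "0 \<le> M"
  shows "\<bar>reaction M x - reaction M y\<bar> \<le> (1 + 5 * M ^ 4) * \<bar>x - y\<bar>"
proof -
  define u where "u = max 0 (min M x)"
  define v where "v = max 0 (min M y)"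
  have uv: "0 \<le> u" "u \<le> M" "0 \<le> v" "v \<le> M" "\<bar>u - v\<bar> \<le> \<bar>x - y\<bar>"
    using assms by (auto simp: u_def v_def)
  define S where "S = u^4 + u^3 * v + u^2 * v^2 + u * v^3 + v^4"
  have "S \<le> M^4 + M^3 * M + M^2 * M^2 + M * M^3 + M^4"
    unfolding S_def using uv assms by (intro add_mono mult_mono power_mono) auto
  also have "\<dots> = 5 * M ^ 4" by (simp add: eval_nat_numeral)
  finally have S: "0 \<le> S" "S \<le> 5 * M ^ 4" using uv by (auto simp: S_def)
  have "(u - u ^ 5) - (v - v ^ 5) = (u - v) * (1 - S)"
    by (simp add: S_def algebra_simps eval_nat_numeral)
  then have "\<bar>(u - u ^ 5) - (v - v ^ 5)\<bar> = \<bar>u - v\<bar> * \<bar>1 - S\<bar>" by (simp add: abs_mult)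
  also have "\<dots> \<le> \<bar>x - y\<bar> * (1 + 5 * M ^ 4)"
    using uv S by (intro mult_mono) auto
  finally show ?thesis by (simp add: reaction_def u_def v_def mult.commute)
qed

text \<open>Squaring smooths the corner of \<open>max 0 x\<close>, and \<open>potential\<close> is a
  polynomial in this square.\<close>

lemma DERIV_max_square: "((\<lambda>x. max 0 x ^ 2) has_real_derivative 2 * max 0 x) (at x)" for x :: real
proof (cases x "0::real" rule: linorder_cases)
  case less
  have "((\<lambda>x::real. 0) has_real_derivative 0) (at x)" by simp
  then show ?thesis
    by (rule has_field_derivative_transform_within_open[of _ _ _ "{..<0}", THEN DERIV_cong])
      (use less in auto)
next
  case equal
  have "((\<lambda>h::real. max 0 h ^ 2 / h) \<longlongrightarrow> 0) (at 0)"
  proof (rule Lim_null_comparison)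
    show "\<forall>\<^sub>F h in at 0. norm (max 0 h ^ 2 / h) \<le> \<bar>h :: real\<bar>"
      by (intro always_eventually) (auto simp: max_def power2_eq_square)
  qed (auto intro!: tendsto_eq_intros)
  then show ?thesis using equal by (simp add: DERIV_def)
next
  case greater
  have "((\<lambda>x::real. x ^ 2) has_real_derivative 2 * x) (at x)" by (auto intro!: derivative_eq_intros)
  then show ?thesis
    by (rule has_field_derivative_transform_within_open[of _ _ _ "{0<..}", THEN DERIV_cong])
      (use greater in auto)
qed

lemma DERIV_potential: "(potential has_real_derivative max 0 x ^ 5 - max 0 x) (at x)"
proof -
  have "((\<lambda>x. (max 0 x ^ 2) ^ 3 / 6 - max 0 x ^ 2 / 2) has_real_derivative
      3 * (max 0 x ^ 2) ^ 2 * (2 * max 0 x) / 6 - 2 * max 0 x / 2) (at x)"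
    by (rule derivative_eq_intros DERIV_max_square refl | simp)+
  then show ?thesis
    by (simp add: potential_def[abs_def] flip: power_mult) (simp add: eval_nat_numeral mult_ac)
qed

text \<open>The factorisation shows that the minimum \<open>- 1/3\<close> is attained only at 1,
  which explains the shift \<open>\<mu> / 3\<close> of the energy below.\<close>

lemma potential_eq: "potential x + 1 / 3 = (max 0 x ^ 2 - 1) ^ 2 * (max 0 x ^ 2 + 2) / 6"
  by (simp add: potential_def algebra_simps eval_nat_numeral)

lemma potential_ge: "- 1 / 3 \<le> potential x"
proof -
  have "0 \<le> potential x + 1 / 3" unfolding potential_eq by simp
  then show ?thesis by simp
qed

lemma potential_gt:
  assumes "x \<noteq> 1"
  shows "- 1 / 3 < potential x"
proof -
  have "max 0 x ^ 2 \<noteq> 1" using assms by (auto simp: max_def power2_eq_1_iff)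
  then have "0 < potential x + 1 / 3" unfolding potential_eq
    by (intro divide_pos_pos mult_pos_pos) (auto simp: add_nonneg_pos)
  then show ?thesis by simp
qed

lemma potential_nonpos:
  assumes "x \<le> 1"
  shows "potential x \<le> - (max 0 x ^ 2) / 3"
proof -
  have "max 0 x ^ 6 \<le> max 0 x ^ 2" using assms by (intro power_decreasing) auto
  then show ?thesis by (simp add: potential_def)
qed

lemma potential_ge_square: "- (max 0 x ^ 2) / 2 \<le> potential x"
  by (simp add: potential_def)

section \<open>Elementary tools for counting by angle and for trapping sign changes\<close>

lemma cos_zero_jump:
  assumes "cos x = 0" "pi / 2 + real n * pi - pi < x"
  shows "pi / 2 + real n * pi \<le> x"
proof -
  obtain i :: int where i: "odd i" "x = of_int i * (pi / 2)" using assms(1) cos_zero_iff_int by auto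
  then obtain m where m: "i = 2 * m + 1" by (auto elim: oddE)
  have "x = pi / 2 + real_of_int m * pi" using i m by (simp add: field_simps)
  then have "(real n - 1) * pi < real_of_int m * pi" using assms by (simp add: algebra_simps)
  then have "real n - 1 < real_of_int m" by simp
  then have "int n \<le> m" by linarith
  then have "real n * pi \<le> real_of_int m * pi" by (intro mult_right_mono) auto
  then show ?thesis using \<open>x = pi / 2 + _\<close> by simp
qed

text \<open>Up to the first time \<open>|f|\<close> reaches \<open>R\<close>, where \<open>g\<close>
  is positive, \<open>g\<close> must change sign. Later \<open>f\<close> is the angle at
  \<open>b\<close> relative to a window centre and \<open>g\<close> is \<open>U a b\<close>, both as
  functions of the initial value.\<close>

lemma trapped_zero_right:
  fixes f g :: "real \<Rightarrow> real"
  assumes "x \<le> y" and f: "continuous_on {x..y} f" and g: "continuous_on {x..y} g"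
    and "\<bar>f x\<bar> < R" "R \<le> \<bar>f y\<bar>" "g x < 0"
    and hit: "\<And>r. r \<in> {x..y} \<Longrightarrow> \<bar>f r\<bar> = R \<Longrightarrow> 0 < g r"
  obtains z where "x < z" "z < y" "g z = 0" "\<bar>f z\<bar> < R"
proof -
  obtain t where t: "x \<le> t" "t \<le> y" "\<bar>f t\<bar> = R" "\<And>r. x \<le> r \<Longrightarrow> r < t \<Longrightarrow> \<bar>f r\<bar> < R"
    using first_hit[of x y "\<lambda>r. \<bar>f r\<bar>" R] assms by (auto intro: continuous_intros)
  have gt: "0 < g t" using hit[of t] t by auto
  have "continuous_on {x..t} g" using t by (intro continuous_on_subset[OF g]) auto
  then obtain z where z: "x \<le> z" "z \<le> t" "g z = 0"
    using IVT'[of g x 0 t] assms gt t by auto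
  then have "z \<noteq> t" "z \<noteq> x" using gt assms by auto
  then show thesis using z t that[of z] by auto
qed

lemma trapped_zero_left:
  fixes f g :: "real \<Rightarrow> real"
  assumes "x \<le> y" and f: "continuous_on {x..y} f" and g: "continuous_on {x..y} g"
    and "R \<le> \<bar>f x\<bar>" "\<bar>f y\<bar> < R" "g y < 0"
    and hit: "\<And>r. r \<in> {x..y} \<Longrightarrow> \<bar>f r\<bar> = R \<Longrightarrow> 0 < g r"
  obtains z where "x < z" "z < y" "g z = 0" "\<bar>f z\<bar> < R"
proof -
  have "continuous_on {- y..- x} (\<lambda>r. f (- r))" "continuous_on {- y..- x} (\<lambda>r. g (- r))"
    by (intro continuous_on_compose2[OF f] continuous_on_compose2[OF g] continuous_intros; auto)+
  then obtain z where "- y < z" "z < - x" "g (- z) = 0" "\<bar>f (- z)\<bar> < R"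
    using trapped_zero_right[of "- y" "- x" "\<lambda>r. f (- r)" "\<lambda>r. g (- r)" R] assms by auto
  then show thesis using that[of "- z"] by auto
qed

section \<open>Energy along the orbits, and the barriers it provides\<close>

locale shooting = cap b for b :: real +
  fixes \<mu> M :: real and U V :: "real \<Rightarrow> real \<Rightarrow> real"
  assumes mu: "0 < \<mu>"
    and M2: "2 \<le> M" and M: "1 / (sin (2 * b))\<^sup>2 < M"
    and U0: "\<And>a. U a 0 = a" and V0: "\<And>a. V a 0 = 0" and Uz: "\<And>t. t \<in> {0..b} \<Longrightarrow> U 0 t = 0"
    and DU: "\<And>a t. t \<in> {0..b} \<Longrightarrow> (U a has_real_derivative V a t) (at t within {0..b})"
    and DP: "\<And>a t. t \<in> {0..b} \<Longrightarrow> ((\<lambda>s. sin (2 * s) * V a s) has_real_derivative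
        sin (2 * t) * (\<mu> * reaction M (U a t))) (at t within {0..b})"
    and contU: "continuous_on (UNIV \<times> {0..b}) (\<lambda>(a, t). U a t)"
    and contV: "continuous_on (UNIV \<times> {0..b}) (\<lambda>(a, t). V a t)"
begin

lemma b0: "0 < b"
  using b pi_gt_zero by linarith

lemma quarter_pos: "pi / 4 \<le> t \<Longrightarrow> 0 < t"
  using pi_gt_zero by linarith

lemma cont_t: "T \<subseteq> {0..b} \<Longrightarrow> continuous_on T (U a)" "T \<subseteq> {0..b} \<Longrightarrow> continuous_on T (V a)"
proof -
  have "continuous_on {0..b} (\<lambda>t. (\<lambda>(a, t). U a t) (a, t))"
    by (rule continuous_on_compose2[OF contU]) (auto intro!: continuous_intros)
  then show "T \<subseteq> {0..b} \<Longrightarrow> continuous_on T (U a)" by (auto intro: continuous_on_subset)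
  have "continuous_on {0..b} (\<lambda>t. (\<lambda>(a, t). V a t) (a, t))"
    by (rule continuous_on_compose2[OF contV]) (auto intro!: continuous_intros)
  then show "T \<subseteq> {0..b} \<Longrightarrow> continuous_on T (V a)" by (auto intro: continuous_on_subset)
qed

lemma cont_a: "t \<in> {0..b} \<Longrightarrow> continuous_on A (\<lambda>a. U a t)"
proof -
  assume "t \<in> {0..b}"
  then have "continuous_on A (\<lambda>a. (\<lambda>(a, t). U a t) (a, t))"
    by (intro continuous_on_compose2[OF contU]) (auto intro!: continuous_intros)
  then show ?thesis by simp
qed

lemma DERIV_U: "0 < t \<Longrightarrow> t < b \<Longrightarrow> (U a has_real_derivative V a t) (at t)"
  using DU[of t a] by (simp add: at_within_Icc_at)

lemma DERIV_V_within:
  assumes t: "0 < t" "t \<le> b"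
  shows "(V a has_real_derivative \<mu> * reaction M (U a t) - 2 * (cos (2 * t) / sin (2 * t)) * V a t)
    (at t within {0..b})"
proof -
  have s: "sin (2 * t) > 0" using sin_double_pos t by simp
  have tb: "t \<in> {0..b}" using t by simp
  have "((\<lambda>s. sin (2 * s)) has_real_derivative 2 * cos (2 * t)) (at t within {0..b})"
    by (auto intro!: derivative_eq_intros)
  from DERIV_divide[OF DP[OF tb, of a] this] s
  have "((\<lambda>s. sin (2 * s) * V a s / sin (2 * s)) has_real_derivative
      (sin (2 * t) * (\<mu> * reaction M (U a t)) * sin (2 * t) - sin (2 * t) * V a t * (2 * cos (2 * t))) /
      (sin (2 * t) * sin (2 * t))) (at t within {0..b})" by simp
  moreover have "(sin (2 * t) * (\<mu> * reaction M (U a t)) * sin (2 * t) - sin (2 * t) * V a t * (2 * cos (2 * t))) /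
      (sin (2 * t) * sin (2 * t)) = \<mu> * reaction M (U a t) - 2 * (cos (2 * t) / sin (2 * t)) * V a t"
    using s by (simp add: field_simps)
  ultimately have D: "((\<lambda>s. sin (2 * s) * V a s / sin (2 * s)) has_real_derivative
      \<mu> * reaction M (U a t) - 2 * (cos (2 * t) / sin (2 * t)) * V a t) (at t within {0..b})" by simp
  show ?thesis
  proof (rule has_field_derivative_transform_within[OF D t(1) tb])
    fix x assume x: "x \<in> {0..b}" "dist x t < t"
    then have "0 < x" by (auto simp: dist_real_def)
    then show "sin (2 * x) * V a x / sin (2 * x) = V a x" using sin_double_pos[of x] x by simp
  qed
qed

lemma DERIV_V:
  "0 < t \<Longrightarrow> t < b \<Longrightarrow>
    (V a has_real_derivative \<mu> * reaction M (U a t) - 2 * (cos (2 * t) / sin (2 * t)) * V a t) (at t)"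
  using DERIV_V_within[of t a] by (simp add: at_within_Icc_at)

definition energy :: "real \<Rightarrow> real \<Rightarrow> real" where
  "energy a t = (V a t)\<^sup>2 / 2 + \<mu> * potential (U a t)"

text \<open>The factor \<open>sin(2t)^2\<close> is an integrating factor: in the derivative the
  terms with \<open>V^2\<close> cancel, leaving \<open>cos (2 * t)\<close> times nonnegative
  quantities. Hence this grows before pi/4 and falls after it, opposite to the energy.\<close>

definition weighted :: "real \<Rightarrow> real \<Rightarrow> real" where
  "weighted a t = (sin (2 * t))\<^sup>2 * (energy a t + \<mu> / 3)"

lemma energy_0: "energy a 0 = \<mu> * potential a"
  by (simp add: energy_def U0 V0)

lemma energy_ge: "\<mu> * potential (U a t) \<le> energy a t"
  by (simp add: energy_def)

lemma DERIV_energy: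
  assumes t: "0 < t" "t < b" and UM: "U a t \<le> M"
  shows "(energy a has_real_derivative - 2 * (cos (2 * t) / sin (2 * t)) * (V a t)\<^sup>2) (at t)"
proof -
  have min: "min M (U a t) = U a t" using UM by simp
  have 1: "((\<lambda>t. (V a t)\<^sup>2 / 2) has_real_derivative
      V a t * (\<mu> * reaction M (U a t) - 2 * (cos (2 * t) / sin (2 * t)) * V a t)) (at t)"
    by (rule DERIV_cong) (rule derivative_eq_intros DERIV_V t refl | simp)+
  have 2: "((\<lambda>t. potential (U a t)) has_real_derivative (max 0 (U a t) ^ 5 - max 0 (U a t)) * V a t) (at t)"
    by (rule DERIV_chain2[OF DERIV_potential DERIV_U[OF t]])
  show ?thesis unfolding energy_def[abs_def]
    by (rule DERIV_cong[OF DERIV_add[OF 1 DERIV_cmult[OF 2, of \<mu>]]])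
      (simp add: reaction_def min algebra_simps power2_eq_square)
qed

lemma cont_energy: "T \<subseteq> {0..b} \<Longrightarrow> continuous_on T (energy a)" "T \<subseteq> {0..b} \<Longrightarrow> continuous_on T (weighted a)"
proof -
  have "continuous_on UNIV potential"
    using DERIV_potential by (intro continuous_at_imp_continuous_on) (auto intro: DERIV_isCont)
  then have c: "T \<subseteq> {0..b} \<Longrightarrow> continuous_on T (\<lambda>t. potential (U a t))" for T
    by (rule continuous_on_compose2[OF _ cont_t(1)]) auto
  show 1: "continuous_on T (energy a)" if "T \<subseteq> {0..b}" for T
    unfolding energy_def[abs_def] using that by (intro continuous_intros c cont_t) auto
  show "continuous_on T (weighted a)" if "T \<subseteq> {0..b}"
    unfolding weighted_def[abs_def] using that by (intro continuous_intros 1)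
qed

lemma DERIV_weighted:
  assumes t: "0 < t" "t < b" and UM: "U a t \<le> M"
  shows "(weighted a has_real_derivative
    4 * sin (2 * t) * cos (2 * t) * (\<mu> * (potential (U a t) + 1 / 3))) (at t)"
proof -
  have s: "sin (2 * t) > 0" using sin_double_pos t by simp
  have D1: "((\<lambda>t. (sin (2 * t))\<^sup>2) has_real_derivative 4 * sin (2 * t) * cos (2 * t)) (at t)"
    by (auto intro!: derivative_eq_intros)
  have "((\<lambda>t. energy a t + \<mu> / 3) has_real_derivative
      - 2 * (cos (2 * t) / sin (2 * t)) * (V a t)\<^sup>2 + 0) (at t)"
    by (intro DERIV_add DERIV_energy t UM DERIV_const)
  from DERIV_mult[OF D1 this] show ?thesis unfolding weighted_def[abs_def]
    by (rule DERIV_cong) (use s in \<open>simp add: energy_def field_simps power2_eq_square\<close>)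
qed

lemma cos_nonneg: "0 \<le> t \<Longrightarrow> t \<le> pi / 4 \<Longrightarrow> 0 \<le> cos (2 * t)"
  by (intro cos_ge_zero) auto

lemma cos_nonpos: "pi / 4 \<le> t \<Longrightarrow> t \<le> b \<Longrightarrow> cos (2 * t) \<le> 0"
proof -
  assume t: "pi / 4 \<le> t" "t \<le> b"
  have "0 \<le> cos (pi - 2 * t)" using t b by (intro cos_ge_zero) auto
  then show ?thesis by simp
qed

lemma energy_decreasing:
  assumes "0 \<le> s" "s \<le> t" "t \<le> pi / 4" and UM: "\<And>r. s < r \<Longrightarrow> r < t \<Longrightarrow> U a r \<le> M"
  shows "energy a t \<le> energy a s"
proof (rule DERIV_nonpos_imp_decreasing_open[OF assms(2)])
  fix r assume r: "s < r" "r < t"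
  have "0 \<le> cos (2 * r)" "0 < sin (2 * r)" using r assms b by (auto intro: cos_nonneg sin_double_pos)
  then have "- 2 * (cos (2 * r) / sin (2 * r)) * (V a r)\<^sup>2 \<le> 0" by (simp add: mult_nonneg_nonneg)
  then show "\<exists>y. (energy a has_real_derivative y) (at r) \<and> y \<le> 0"
    using DERIV_energy[of r a] UM[of r] r assms b by fastforce
qed (use assms b in \<open>auto intro: cont_energy\<close>)

lemma energy_increasing:
  assumes "pi / 4 \<le> s" "s \<le> t" "t \<le> b" and UM: "\<And>r. s < r \<Longrightarrow> r < t \<Longrightarrow> U a r \<le> M"
  shows "energy a s \<le> energy a t"
proof (rule DERIV_nonneg_imp_increasing_open[OF assms(2)])
  have s0: "0 < s" using assms pi_gt_zero by linarith
  fix r assume r: "s < r" "r < t"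
  have "cos (2 * r) \<le> 0" "0 < sin (2 * r)" using r assms s0 by (auto intro: cos_nonpos sin_double_pos)
  then have "0 \<le> - 2 * (cos (2 * r) / sin (2 * r)) * (V a r)\<^sup>2"
    by (simp add: divide_nonpos_pos mult_nonpos_nonneg)
  then show "\<exists>y. (energy a has_real_derivative y) (at r) \<and> 0 \<le> y"
    using DERIV_energy[of r a] UM[of r] r assms s0 by fastforce
next
  show "continuous_on {s..t} (energy a)"
    using assms quarter_pos[of s] by (intro cont_energy) auto
qed

lemma weighted_increasing:
  assumes "0 \<le> s" "s \<le> t" "t \<le> pi / 4" and UM: "\<And>r. s < r \<Longrightarrow> r < t \<Longrightarrow> U a r \<le> M"
  shows "weighted a s \<le> weighted a t"
proof (rule DERIV_nonneg_imp_increasing_open[OF assms(2)])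
  fix r assume r: "s < r" "r < t"
  have "0 \<le> cos (2 * r)" "0 < sin (2 * r)" using r assms b by (auto intro: cos_nonneg sin_double_pos)
  then have "0 \<le> 4 * sin (2 * r) * cos (2 * r) * (\<mu> * (potential (U a r) + 1 / 3))"
    using mu potential_ge[of "U a r"] by (intro mult_nonneg_nonneg) auto
  then show "\<exists>y. (weighted a has_real_derivative y) (at r) \<and> 0 \<le> y"
    using DERIV_weighted[of r a] UM[of r] r assms b by fastforce
qed (use assms b in \<open>auto intro: cont_energy\<close>)

lemma weighted_decreasing:
  assumes "pi / 4 \<le> s" "s \<le> t" "t \<le> b" and UM: "\<And>r. s < r \<Longrightarrow> r < t \<Longrightarrow> U a r \<le> M"
  shows "weighted a t \<le> weighted a s"
proof (rule DERIV_nonpos_imp_decreasing_open[OF assms(2)])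
  have s0: "0 < s" using assms pi_gt_zero by linarith
  fix r assume r: "s < r" "r < t"
  have "cos (2 * r) \<le> 0" "0 < sin (2 * r)" using r assms s0 by (auto intro: cos_nonpos sin_double_pos)
  moreover have "0 \<le> \<mu> * (potential (U a r) + 1 / 3)"
    using mu potential_ge[of "U a r"] by (intro mult_nonneg_nonneg) auto
  ultimately have "4 * sin (2 * r) * cos (2 * r) * (\<mu> * (potential (U a r) + 1 / 3)) \<le> 0"
    by (intro mult_nonpos_nonneg[of "4 * sin (2 * r) * cos (2 * r)"] mult_nonneg_nonpos) auto
  then show "\<exists>y. (weighted a has_real_derivative y) (at r) \<and> y \<le> 0"
    using DERIV_weighted[of r a] UM[of r] r assms s0 by fastforce
next
  show "continuous_on {s..t} (weighted a)"
    using assms quarter_pos[of s] by (intro cont_energy) auto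
qed

lemma sin_ge_end: "pi / 4 \<le> t \<Longrightarrow> t \<le> b \<Longrightarrow> sin (2 * b) \<le> sin (2 * t)"
  using sin_double_ge_mult[of "pi / 4" t] by simp

text \<open>The truncation at \<open>M\<close> is never active.\<close>
lemma U_less_M:
  assumes a: "a \<in> {0<..<1}" and t: "t \<in> {0..b}"
  shows "U a t < M"
proof (rule ccontr)
  assume "\<not> U a t < M"
  then obtain t1 where t1: "0 \<le> t1" "t1 \<le> t" "U a t1 = M" "\<And>r. 0 \<le> r \<Longrightarrow> r < t1 \<Longrightarrow> U a r < M"
    using first_hit[of 0 t "U a" M] cont_t(1)[of "{0..t}" a] t a U0[of a] M2 by auto
  have UM: "U a r \<le> M" if "0 \<le> r" "r < t1" for r using t1(4)[OF that] by simp
  have F0: "\<mu> * potential a \<le> 0"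
    using potential_nonpos[of a] a mu by (intro mult_nonneg_nonpos) (auto intro: order_trans)
  have FM: "M < potential M"
  proof -
    have "2 ^ 4 \<le> M ^ 4" using M2 by (intro power_mono) auto
    then have "M ^ 2 * (13 / 6) \<le> M ^ 2 * ((M ^ 4 - 3) / 6)" by (intro mult_left_mono) auto
    also have "\<dots> = potential M" using M2 by (simp add: potential_def max_def field_simps eval_nat_numeral)
    finally have "M ^ 2 * (13 / 6) \<le> potential M" .
    moreover have "M * 2 \<le> M ^ 2" unfolding power2_eq_square using M2 by (intro mult_left_mono) auto
    ultimately show ?thesis using M2 by linarith
  qed
  show False
  proof (cases "t1 \<le> pi / 4")
    case True
    have "energy a t1 \<le> energy a 0" by (rule energy_decreasing) (use True t1(1) UM in auto)
    moreover have "\<mu> * M < energy a t1"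
      using energy_ge[of a t1] FM mu t1(3) by (smt (verit) mult_strict_left_mono)
    moreover have "0 < \<mu> * M" using mu M2 by simp
    ultimately show False using F0 energy_0[of a] by linarith
  next
    case False
    have e: "energy a (pi / 4) \<le> energy a 0"
      by (rule energy_decreasing) (use False t1 UM in auto)
    \<comment> \<open>At pi/4 the weight is 1 and the energy is nonpositive, so
      \<open>weighted\<close> is at most \<open>\<mu> / 3\<close> from there on. At height
      \<open>M\<close> it would be at least \<open>sin(2b)^2 \<mu> M\<close>, which exceeds
      \<open>\<mu>\<close> by the choice of \<open>M\<close>.\<close>
    have "weighted a t1 \<le> weighted a (pi / 4)"
    proof (rule weighted_decreasing)
      show "U a r \<le> M" if "pi / 4 < r" "r < t1" for r using UM[of r] quarter_pos[of r] that by auto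
    qed (use False t1(1,2) t in auto)
    also have "\<dots> \<le> \<mu> / 3" using e F0 energy_0[of a] by (simp add: weighted_def)
    finally have w: "weighted a t1 \<le> \<mu> / 3" .
    have s: "0 < sin (2 * b)" using sin_double_pos[of b] b0 by simp
    have "(sin (2 * b))\<^sup>2 \<le> (sin (2 * t1))\<^sup>2"
      using s sin_ge_end[of t1] False t1 t by (intro power_mono) auto
    moreover have "\<mu> * M \<le> energy a t1 + \<mu> / 3"
    proof -
      have "\<mu> * M \<le> \<mu> * potential M" using FM mu by simp
      then show ?thesis using energy_ge[of a t1, unfolded t1(3)] mu by linarith
    qed
    ultimately have "(sin (2 * b))\<^sup>2 * (\<mu> * M) \<le> weighted a t1"
      unfolding weighted_def using mu M2 by (intro mult_mono) auto
    moreover have "1 < M * (sin (2 * b))\<^sup>2" using M s by (simp add: field_simps)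
    then have "\<mu> * 1 < \<mu> * (M * (sin (2 * b))\<^sup>2)" using mu by (intro mult_strict_left_mono)
    moreover have "(sin (2 * b))\<^sup>2 * (\<mu> * M) = \<mu> * (M * (sin (2 * b))\<^sup>2)" by simp
    ultimately show False using w mu by linarith
  qed
qed

text \<open>At \<open>(1, 0)\<close> the shifted energy \<open>energy + \<mu>/3\<close> is 0. It is
  positive somewhere early, stays so up to pi/4 because \<open>weighted\<close> grows, and
  afterwards because the energy grows. This makes a polar angle around the rest point
  possible.\<close>

lemma U_V_not_equilibrium:
  assumes a: "a \<in> {0<..<1}" and t: "t \<in> {0..b}"
  shows "U a t \<noteq> 1 \<or> V a t \<noteq> 0"
proof (rule ccontr)
  assume "\<not> ?thesis"
  then have eq: "U a t = 1" "V a t = 0" by auto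
  have e0: "energy a t + \<mu> / 3 = 0" by (simp add: energy_def eq potential_def)
  have UM: "U a r \<le> M" if "r \<in> {0..b}" for r using U_less_M[OF a that] by simp
  have "t \<noteq> 0" using U0[of a] eq a by auto
  define s0 where "s0 = min t (pi / 4)"
  have s0: "0 < s0" "s0 \<le> t" "s0 \<le> pi / 4" using t \<open>t \<noteq> 0\<close> by (auto simp: s0_def)
  \<comment> \<open>The weight vanishes at 0, so a strictly positive starting point off the level 1
    is required; one exists before the first time \<open>U\<close> equals 1.\<close>
  have "\<exists>s. 0 < s \<and> s \<le> s0 \<and> U a s \<noteq> 1"
  proof (cases "U a s0 = 1")
    case False
    then show ?thesis using s0 by auto
  next
    case True
    obtain t1 where t1: "0 \<le> t1" "t1 \<le> s0" "U a t1 = 1" "\<And>r. 0 \<le> r \<Longrightarrow> r < t1 \<Longrightarrow> U a r < 1"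
      using first_hit[of 0 s0 "U a" 1] cont_t(1)[of "{0..s0}" a] s0 t True U0[of a] a by auto
    have "t1 \<noteq> 0" using t1(3) U0[of a] a by auto
    then show ?thesis using t1(1,2) t1(4)[of "t1 / 2"] by (intro exI[of _ "t1 / 2"]) auto
  qed
  then obtain s where s: "0 < s" "s \<le> s0" "U a s \<noteq> 1" by auto
  have "0 < \<mu> * (potential (U a s) + 1 / 3)" using potential_gt[OF s(3)] mu by (intro mult_pos_pos) auto
  then have "0 < energy a s + \<mu> / 3" using energy_ge[of a s] by (simp add: algebra_simps)
  then have "0 < weighted a s" unfolding weighted_def using sin_double_pos[of s] s s0 t by simp
  also have "\<dots> \<le> weighted a s0"
    by (rule weighted_increasing) (use s s0 t b in \<open>auto intro!: UM\<close>)
  finally have w: "0 < weighted a s0" .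
  show False
  proof (cases "t \<le> pi / 4")
    case True
    then show False using w e0 by (simp add: s0_def weighted_def)
  next
    case False
    then have "0 < energy a (pi / 4) + \<mu> / 3" using w by (simp add: s0_def weighted_def)
    moreover have "energy a (pi / 4) \<le> energy a t"
    proof (rule energy_increasing)
      show "U a r \<le> M" if "pi / 4 < r" "r < t" for r using UM[of r] quarter_pos[of r] that t by auto
    qed (use False t in auto)
    ultimately show False using e0 by linarith
  qed
qed

lemma reaction_bound: "\<bar>reaction M x\<bar> \<le> (1 + 5 * M ^ 4) * \<bar>x\<bar>"
  using reaction_lipschitz[of M x 0] M2 by (simp add: reaction_def)

text \<open>Backward Gronwall argument: \<open>U^2\<close> plus the squared flux changes at most at
  the relative rate \<open>C\<close>, so its product with \<open>exp (C r)\<close> is nondecreasing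
  and cannot fall from a positive value to 0. Starting at \<open>s > 0\<close> keeps
  \<open>1/sin(2r)\<close> bounded.\<close>

lemma flux_nonzero_at_zero:
  assumes s: "0 < s" "s \<le> t" "t \<le> b" and Us: "U a s \<noteq> 0" and Ut: "U a t = 0"
  shows "V a t \<noteq> 0"
proof
  assume Vt: "V a t = 0"
  define \<rho> where "\<rho> = sin (2 * b) * sin (2 * s)"
  have \<rho>: "0 < \<rho>" unfolding \<rho>_def using s b0 by (intro mult_pos_pos sin_double_pos) auto
  define L where "L = \<mu> * (1 + 5 * M ^ 4)"
  define P where "P r = sin (2 * r) * V a r" for r
  define G where "G r = (U a r)\<^sup>2 + (P r)\<^sup>2" for r
  define C where "C = 1 / \<rho> + L"
  have L0: "0 \<le> L" using mu by (simp add: L_def)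
  have cont: "continuous_on {s..t} (\<lambda>r. exp (C * r) * G r)"
    unfolding G_def P_def using s by (intro continuous_intros cont_t) auto
  have "exp (C * s) * G s \<le> exp (C * t) * G t"
  proof (rule DERIV_nonneg_imp_increasing_open[OF s(2) _ cont])
    fix r assume r: "s < r" "r < t"
    define h where "h = \<mu> * reaction M (U a r)"
    define x where "x = U a r"
    define y where "y = P r"
    define \<sigma> where "\<sigma> = sin (2 * r)"
    have \<sigma>: "\<rho> \<le> \<sigma>" "\<sigma> \<le> 1" unfolding \<rho>_def \<sigma>_def using sin_double_ge_mult[of s r] r s by auto
    have V: "V a r = y / \<sigma>" unfolding y_def P_def using \<sigma> \<rho> by (simp add: \<sigma>_def)
    have DUr: "(U a has_real_derivative V a r) (at r)" by (rule DERIV_U) (use r s in auto)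
    have DPr: "(P has_real_derivative \<sigma> * h) (at r)"
      unfolding P_def h_def \<sigma>_def using DP[of r a] r s by (simp add: at_within_Icc_at)
    have "((\<lambda>r. exp (C * r) * G r) has_real_derivative
        exp (C * r) * (C * (x\<^sup>2 + y\<^sup>2) + (2 * x * (y / \<sigma>) + 2 * y * (\<sigma> * h)))) (at r)"
      unfolding G_def
      by (rule derivative_eq_intros DUr DPr refl | simp)+ (simp add: x_def y_def V algebra_simps)
    moreover have "0 \<le> C * (x\<^sup>2 + y\<^sup>2) + (2 * x * (y / \<sigma>) + 2 * y * (\<sigma> * h))"
    proof -
      have amgm: "2 * (\<bar>x\<bar> * \<bar>y\<bar>) \<le> x\<^sup>2 + y\<^sup>2"
        using sum_squares_bound[of "\<bar>x\<bar>" "\<bar>y\<bar>"] by simp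
      have "\<bar>2 * x * (y / \<sigma>)\<bar> = (1 / \<sigma>) * (2 * (\<bar>x\<bar> * \<bar>y\<bar>))" using \<sigma> \<rho> by (simp add: abs_mult)
      also have "\<dots> \<le> (1 / \<rho>) * (x\<^sup>2 + y\<^sup>2)"
        using \<sigma> \<rho> by (intro mult_mono amgm) (auto simp: frac_le)
      finally have 1: "\<bar>2 * x * (y / \<sigma>)\<bar> \<le> (1 / \<rho>) * (x\<^sup>2 + y\<^sup>2)" .
      have h: "\<bar>h\<bar> \<le> L * \<bar>x\<bar>"
        unfolding h_def L_def x_def using reaction_bound[of "U a r"] mu by (simp add: abs_mult mult.assoc)
      have "\<bar>2 * y * (\<sigma> * h)\<bar> = 2 * \<bar>y\<bar> * (\<sigma> * \<bar>h\<bar>)" using \<sigma> \<rho> by (simp add: abs_mult)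
      also have "\<dots> \<le> 2 * \<bar>y\<bar> * (1 * (L * \<bar>x\<bar>))"
        using \<sigma> \<rho> h by (intro mult_left_mono mult_mono) auto
      also have "\<dots> = L * (2 * (\<bar>x\<bar> * \<bar>y\<bar>))" by simp
      also have "\<dots> \<le> L * (x\<^sup>2 + y\<^sup>2)" by (rule mult_left_mono[OF amgm L0])
      finally have 2: "\<bar>2 * y * (\<sigma> * h)\<bar> \<le> L * (x\<^sup>2 + y\<^sup>2)" .
      have "C * (x\<^sup>2 + y\<^sup>2) = (1 / \<rho>) * (x\<^sup>2 + y\<^sup>2) + L * (x\<^sup>2 + y\<^sup>2)"
        by (simp add: C_def distrib_right)
      then show ?thesis using 1 2 by linarith
    qed
    ultimately show "\<exists>y. ((\<lambda>r. exp (C * r) * G r) has_real_derivative y) (at r) \<and> 0 \<le> y"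
      by (intro exI[of _ "exp (C * r) * (C * (x\<^sup>2 + y\<^sup>2) + (2 * x * (y / \<sigma>) + 2 * y * (\<sigma> * h)))"] conjI)
        (auto intro: mult_nonneg_nonneg)
  qed
  moreover have "G t = 0" by (simp add: G_def P_def Ut Vt)
  moreover have "0 < G s" unfolding G_def using Us by (simp add: add_pos_nonneg)
  ultimately show False by (simp add: mult_le_0_iff not_le[symmetric])
qed

text \<open>As the reaction vanishes on the negative axis, the flux of \<open>U\<close> is frozen once \<open>U\<close> has
  become negative.\<close>
lemma U_negative_after_zero:
  assumes a: "a \<in> {0<..<1}" and s: "0 \<le> s" "s < t" "t \<le> b" and Us: "U a s \<le> 0"
  shows "U a t < 0"
proof -
  have a0: "0 < a" using a by simp
  obtain t0 where t0: "0 \<le> t0" "t0 \<le> s" "U a t0 = 0" "\<And>r. 0 \<le> r \<Longrightarrow> r < t0 \<Longrightarrow> 0 < U a r"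
    using first_hit[of 0 s "\<lambda>r. - U a r" 0] cont_t(1)[of "{0..s}" a] s Us U0[of a] a0
    by (auto intro: continuous_intros)
  have "t0 \<noteq> 0" using t0(3) U0[of a] a0 by auto
  then have pos: "0 < t0" "t0 < b" using t0(1,2) s by auto
  have nz: "V a t0 \<noteq> 0"
    by (rule flux_nonzero_at_zero[of "t0 / 2"]) (use t0(3) t0(4)[of "t0 / 2"] pos in auto)
  have D0: "(U a has_real_derivative V a t0) (at t0)" by (rule DERIV_U[OF pos])
  have V0: "V a t0 < 0"
  proof (rule ccontr)
    assume "\<not> V a t0 < 0"
    then have "0 < V a t0" using nz by simp
    from DERIV_pos_inc_left[OF D0 this] obtain d where d: "0 < d" "\<And>h. 0 < h \<Longrightarrow> h < d \<Longrightarrow> U a (t0 - h) < U a t0"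
      by auto
    define h where "h = min (d / 2) (t0 / 2)"
    have h: "0 < h" "h < d" "0 \<le> t0 - h" "t0 - h < t0" using d(1) pos by (auto simp: h_def)
    then show False using t0(3) t0(4)[of "t0 - h"] d(2)[of h] by simp
  qed
  from DERIV_neg_dec_right[OF D0 V0] obtain d where d: "0 < d" "\<And>h. 0 < h \<Longrightarrow> h < d \<Longrightarrow> U a (t0 + h) < U a t0"
    by auto
  show ?thesis
  proof (rule ccontr)
    assume Ut: "\<not> U a t < 0"
    define r1 where "r1 = t0 + min (d / 2) ((t - t0) / 2)"
    have r1: "t0 < r1" "r1 < t" using d s t0(2) by (auto simp: r1_def min_def field_simps)
    have "r1 < t0 + d" using d(1) by (auto simp: r1_def)
    then have neg1: "U a r < 0" if "t0 < r" "r \<le> r1" for r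
      using d(2)[of "r - t0"] that t0(3) by auto
    obtain t1 where t1: "r1 \<le> t1" "t1 \<le> t" "U a t1 = 0" "\<And>r. r1 \<le> r \<Longrightarrow> r < t1 \<Longrightarrow> U a r < 0"
      using first_hit[of r1 t "U a" 0] cont_t(1)[of "{r1..t}" a] r1 pos s(3) neg1[of r1] Ut by auto
    have neg: "U a r \<le> 0" if "t0 < r" "r < t1" for r
      using neg1[of r] t1(4)[of r] that by fastforce
    have Pneg: "sin (2 * r) * V a r \<le> sin (2 * t0) * V a t0" if r: "t0 < r" "r < t1" for r
    proof (rule DERIV_nonpos_imp_decreasing_open[where f = "\<lambda>s. sin (2 * s) * V a s"])
      fix x assume x: "t0 < x" "x < r"
      have "reaction M (U a x) = 0" using neg[of x] x r M2 by (simp add: reaction_def max_def min_def)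
      then show "\<exists>y. ((\<lambda>s. sin (2 * s) * V a s) has_real_derivative y) (at x) \<and> y \<le> 0"
        using DP[of x a] x r pos t1(2) s by (simp add: at_within_Icc_at) blast
    next
      show "continuous_on {t0..r} (\<lambda>s. sin (2 * s) * V a s)"
        using r pos t1(2) s by (intro continuous_intros cont_t) auto
    qed (use r in auto)
    have "U a t1 < U a t0"
    proof (rule DERIV_neg_imp_decreasing_open[where f = "U a"])
      fix r assume r: "t0 < r" "r < t1"
      have rb: "0 < r" "r < b" using r pos t1(2) s by auto
      have "sin (2 * r) * V a r < 0"
        using Pneg[OF r] mult_pos_neg[OF sin_double_pos[of t0] V0] pos by auto
      then have "V a r < 0" using sin_double_pos[of r] rb by (simp add: mult_less_0_iff)
      then show "\<exists>y. (U a has_real_derivative y) (at r) \<and> y < 0" using DERIV_U[OF rb] by blast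
    next
      show "continuous_on {t0..t1} (U a)" using pos t1(2) s by (intro cont_t) auto
    qed (use r1 t1 in auto)
    then show False using t1(3) t0(3) by simp
  qed
qed

section \<open>The polar angle and its behaviour at crossings of the level 1\<close>

lemma angle_exists:
  obtains \<phi> :: "real \<Rightarrow> real \<Rightarrow> real" where
    "continuous_on ({0<..<1} \<times> {0..b}) (\<lambda>(a, t). \<phi> a t)"
    "\<And>a. a \<in> {0<..<1} \<Longrightarrow> \<phi> a 0 = 0"
    "\<And>a t. a \<in> {0<..<1} \<Longrightarrow> t \<in> {0..b} \<Longrightarrow>
      \<exists>r>0. 1 - U a t = r * cos (\<phi> a t) \<and> V a t = r * sin (\<phi> a t)"
proof -
  define S where "S = {0<..<1::real} \<times> {0..b}"
  \<comment> \<open>The curve never meets 0, and the parameter rectangle is contractible, so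
    \<open>f\<close> has a continuous logarithm; its imaginary part is an angle jointly continuous
    in \<open>a\<close> and \<open>t\<close>.\<close>
  define f where "f = (\<lambda>(a, t). Complex (1 - U a t) (V a t))"
  have cU: "continuous_on S (\<lambda>x. U (fst x) (snd x))" "continuous_on S (\<lambda>x. V (fst x) (snd x))"
    using contU contV by (auto simp: S_def case_prod_beta' intro: continuous_on_subset)
  have "continuous_on S f" unfolding f_def case_prod_beta' by (intro continuous_intros cU)
  moreover have "contractible S"
    unfolding S_def by (intro convex_imp_contractible convex_Times) auto
  moreover have "f z \<noteq> 0" if "z \<in> S" for z
    using U_V_not_equilibrium[of "fst z" "snd z"] that
    by (auto simp: f_def S_def complex_eq_iff split: prod.splits)
  ultimately obtain g where g: "continuous_on S g" "\<And>z. z \<in> S \<Longrightarrow> f z = exp (g z)"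
    using continuous_logarithm_on_contractible[of S f] by metis
  have rect: "1 - U a t = exp (Re (g (a, t))) * cos (Im (g (a, t)))"
    "V a t = exp (Re (g (a, t))) * sin (Im (g (a, t)))" if "a \<in> {0<..<1}" "t \<in> {0..b}" for a t
  proof -
    have e: "f (a, t) = exp (g (a, t))" using that by (intro g(2)) (simp add: S_def)
    then have "Re (f (a, t)) = Re (exp (g (a, t)))" "Im (f (a, t)) = Im (exp (g (a, t)))" by simp_all
    then show "1 - U a t = exp (Re (g (a, t))) * cos (Im (g (a, t)))"
      "V a t = exp (Re (g (a, t))) * sin (Im (g (a, t)))"
      by (simp_all add: f_def Re_exp Im_exp)
  qed
  \<comment> \<open>At \<open>t = 0\<close> the value \<open>1 - a\<close> is real and positive, so
    the subtracted term is a multiple of 2 pi: cosine and sine are unchanged, and every orbit starts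
    at angle 0.\<close>
  define \<phi> where "\<phi> a t = Im (g (a, t)) - Im (g (a, 0))" for a t
  show thesis
  proof
    have "continuous_on S (\<lambda>x. g (fst x, 0))"
      by (rule continuous_on_compose2[OF g(1)]) (use b0 in \<open>auto simp: S_def intro!: continuous_intros\<close>)
    then show "continuous_on ({0<..<1} \<times> {0..b}) (\<lambda>(a, t). \<phi> a t)"
      unfolding \<phi>_def case_prod_beta' S_def[symmetric] using g(1) by (intro continuous_intros) auto
    show "\<phi> a 0 = 0" for a by (simp add: \<phi>_def)
    fix a t assume a: "a \<in> {0<..<1::real}" and t: "t \<in> {0..b}"
    define \<psi> where "\<psi> = Im (g (a, 0))"
    have r0: "1 - a = exp (Re (g (a, 0))) * cos \<psi>" "0 = exp (Re (g (a, 0))) * sin \<psi>"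
      using rect[OF a, of 0] b0 by (simp_all add: U0 V0 \<psi>_def)
    have "0 < exp (Re (g (a, 0))) * cos \<psi>" unfolding r0(1)[symmetric] using a by simp
    then have pos: "0 < cos \<psi>" by (simp add: zero_less_mult_iff)
    have sin0: "sin \<psi> = 0" using r0(2) by simp
    have "cos \<psi> = 1" using sin_cos_squared_add[of \<psi>] sin0 pos by (auto simp: power2_eq_1_iff)
    with sin0 have "cos (\<phi> a t) = cos (Im (g (a, t)))" "sin (\<phi> a t) = sin (Im (g (a, t)))"
      by (simp_all add: \<phi>_def cos_diff sin_diff \<psi>_def)
    then show "\<exists>r>0. 1 - U a t = r * cos (\<phi> a t) \<and> V a t = r * sin (\<phi> a t)"
      using rect[OF a t] by (intro exI[of _ "exp (Re (g (a, t)))"]) auto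
  qed
qed

end

locale shooting_angle = shooting +
  fixes \<phi> :: "real \<Rightarrow> real \<Rightarrow> real"
  assumes cont_\<phi>: "continuous_on ({0<..<1} \<times> {0..b}) (\<lambda>(a, t). \<phi> a t)"
    and \<phi>_0: "\<And>a. a \<in> {0<..<1} \<Longrightarrow> \<phi> a 0 = 0"
    and polar: "\<And>a t. a \<in> {0<..<1} \<Longrightarrow> t \<in> {0..b} \<Longrightarrow>
      \<exists>r>0. 1 - U a t = r * cos (\<phi> a t) \<and> V a t = r * sin (\<phi> a t)"
begin

lemma cont_\<phi>_t: "a \<in> {0<..<1} \<Longrightarrow> T \<subseteq> {0..b} \<Longrightarrow> continuous_on T (\<phi> a)"
proof -
  assume "a \<in> {0<..<1}" "T \<subseteq> {0..b}"
  then have "continuous_on T (\<lambda>t. (\<lambda>(a, t). \<phi> a t) (a, t))"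
    by (intro continuous_on_compose2[OF cont_\<phi>]) (auto intro!: continuous_intros)
  then show ?thesis by simp
qed

lemma cont_\<phi>_a: "A \<subseteq> {0<..<1} \<Longrightarrow> t \<in> {0..b} \<Longrightarrow> continuous_on A (\<lambda>a. \<phi> a t)"
proof -
  assume "A \<subseteq> {0<..<1}" "t \<in> {0..b}"
  then have "continuous_on A (\<lambda>a. (\<lambda>(a, t). \<phi> a t) (a, t))"
    by (intro continuous_on_compose2[OF cont_\<phi>]) (auto intro!: continuous_intros)
  then show ?thesis by simp
qed

lemma U_eq_1_iff: "a \<in> {0<..<1} \<Longrightarrow> t \<in> {0..b} \<Longrightarrow> U a t = 1 \<longleftrightarrow> cos (\<phi> a t) = 0"
  using polar[of a t] by auto

text \<open>With \<open>\<sigma> = sin (\<phi> a z)\<close>, equal to 1 or -1, the function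
  \<open>\<sigma> (U - 1)\<close> is a positive multiple of
  \<open>sin (\<phi> a t - \<phi> a z)\<close> and has derivative
  \<open>\<sigma> * V a z > 0\<close> at \<open>z\<close>. Thus the angle increases through a
  crossing in either direction of \<open>U\<close>.\<close>

lemma angle_near_crossing:
  assumes a: "a \<in> {0<..<1}" and z: "z \<in> {0..b}" and Uz: "U a z = 1"
  obtains d where "0 < d"
    "\<And>t. t \<in> {0..b} \<Longrightarrow> z - d < t \<Longrightarrow> t < z \<Longrightarrow> \<phi> a t < \<phi> a z"
    "\<And>t. t \<in> {0..b} \<Longrightarrow> z < t \<Longrightarrow> t < z + d \<Longrightarrow> \<phi> a z < \<phi> a t"
proof -
  have c0: "cos (\<phi> a z) = 0" using Uz U_eq_1_iff[OF a z] by simp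
  define \<sigma> where "\<sigma> = sin (\<phi> a z)"
  have \<sigma>2: "\<sigma> * \<sigma> = 1" using sin_cos_squared_add[of "\<phi> a z"] c0 by (simp add: \<sigma>_def power2_eq_square)
  obtain r0 where r0: "0 < r0" "V a z = r0 * \<sigma>" using polar[OF a z] by (auto simp: \<sigma>_def)
  define f where "f t = \<sigma> * (U a t - 1)" for t
  have Df: "(f has_real_derivative r0) (at z within {0..b})"
    unfolding f_def by (rule derivative_eq_intros DU[OF z] refl | simp)+ (use \<sigma>2 r0 in \<open>simp add: mult_ac\<close>)
  have fz: "f z = 0" by (simp add: f_def Uz)
  have sgn: "\<exists>r>0. f t = r * sin (\<phi> a t - \<phi> a z)" if t: "t \<in> {0..b}" for t
  proof -
    obtain r where r: "0 < r" "1 - U a t = r * cos (\<phi> a t)" using polar[OF a t] by auto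
    have "cos (\<phi> a t) = cos (\<phi> a z + (\<phi> a t - \<phi> a z))" by simp
    also have "\<dots> = - \<sigma> * sin (\<phi> a t - \<phi> a z)" unfolding cos_add c0 \<sigma>_def by simp
    finally have "1 - U a t = - (\<sigma> * (r * sin (\<phi> a t - \<phi> a z)))" using r(2) by simp
    then have "U a t - 1 = \<sigma> * (r * sin (\<phi> a t - \<phi> a z))" by linarith
    then have "f t = (\<sigma> * \<sigma>) * (r * sin (\<phi> a t - \<phi> a z))" by (simp add: f_def)
    then show ?thesis using r \<sigma>2 by auto
  qed
  obtain d1 where d1: "0 < d1" "\<And>h. 0 < h \<Longrightarrow> z + h \<in> {0..b} \<Longrightarrow> h < d1 \<Longrightarrow> f z < f (z + h)"
    using has_real_derivative_pos_inc_right[OF Df r0(1)] by auto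
  obtain d2 where d2: "0 < d2" "\<And>h. 0 < h \<Longrightarrow> z - h \<in> {0..b} \<Longrightarrow> h < d2 \<Longrightarrow> f (z - h) < f z"
    using has_real_derivative_pos_inc_left[OF Df r0(1)] by auto
  \<comment> \<open>An angle difference below pi in modulus has the sign of its sine.\<close>
  have "continuous_on {0..b} (\<phi> a)" by (rule cont_\<phi>_t[OF a]) simp
  then obtain d3 where d3: "0 < d3" "\<And>t. t \<in> {0..b} \<Longrightarrow> dist t z < d3 \<Longrightarrow> dist (\<phi> a t) (\<phi> a z) < pi"
    using z pi_gt_zero by (meson continuous_on_iff)
  show thesis
  proof
    show "0 < Min {d1, d2, d3}" using d1 d2 d3 by simp
    fix t assume t: "t \<in> {0..b}"
    obtain r where r: "0 < r" "f t = r * sin (\<phi> a t - \<phi> a z)" using sgn[OF t] by auto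
    {
      assume "z - Min {d1, d2, d3} < t" "t < z"
      then have "z - t < d2" "\<bar>\<phi> a t - \<phi> a z\<bar> < pi" using d3(2)[OF t] by (auto simp: dist_real_def)
      moreover from this have "f t < 0" using d2(2)[of "z - t"] \<open>t < z\<close> t fz by simp
      then have "sin (\<phi> a t - \<phi> a z) < 0" using r by (simp add: mult_less_0_iff)
      moreover have "0 \<le> sin (\<phi> a t - \<phi> a z)" if "\<phi> a z \<le> \<phi> a t"
        using that calculation(2) by (intro sin_ge_zero) auto
      ultimately show "\<phi> a t < \<phi> a z" by (meson not_le)
    }
    {
      assume "z < t" "t < z + Min {d1, d2, d3}"
      then have "t - z < d1" "\<bar>\<phi> a t - \<phi> a z\<bar> < pi" using d3(2)[OF t] by (auto simp: dist_real_def)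
      moreover from this have "0 < f t" using d1(2)[of "t - z"] \<open>z < t\<close> t fz by simp
      then have "0 < sin (\<phi> a t - \<phi> a z)" using r by (simp add: zero_less_mult_iff)
      then have "sin (\<phi> a z - \<phi> a t) < 0" using sin_minus[of "\<phi> a t - \<phi> a z"] by simp
      moreover have "0 \<le> sin (\<phi> a z - \<phi> a t)" if "\<phi> a t \<le> \<phi> a z"
        using that calculation(2) by (intro sin_ge_zero) auto
      ultimately show "\<phi> a z < \<phi> a t" by (meson not_le)
    }
  qed
qed

text \<open>If the angle had been as large earlier, it would have come down through the value
  \<open>\<phi> a z\<close>. The last such point is again a crossing of 1, and crossings are passed
  upwards only.\<close>

lemma angle_before_crossing:
  assumes a: "a \<in> {0<..<1}" and t: "0 \<le> t" "t < z" "z \<le> b" and Uz: "U a z = 1"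
  shows "\<phi> a t < \<phi> a z"
proof (rule ccontr)
  assume ge: "\<not> \<phi> a t < \<phi> a z"
  have z: "z \<in> {0..b}" using t by auto
  obtain d where d: "0 < d" "\<And>t. t \<in> {0..b} \<Longrightarrow> z - d < t \<Longrightarrow> t < z \<Longrightarrow> \<phi> a t < \<phi> a z"
    using angle_near_crossing[OF a z Uz] by metis
  define s where "s = (max t (z - d) + z) / 2"
  have s: "t < s" "s < z" "z - d < s" using t d(1) by (auto simp: s_def field_simps max_def)
  have sl: "\<phi> a s < \<phi> a z" using d(2)[of s] s t by auto
  obtain z' where z': "t \<le> z'" "z' \<le> s" "\<phi> a z' = \<phi> a z" "\<And>r. z' < r \<Longrightarrow> r \<le> s \<Longrightarrow> \<phi> a r < \<phi> a z"
    using last_hit[of t s "\<lambda>x. - \<phi> a x" "- \<phi> a z"] cont_\<phi>_t[OF a, of "{t..s}"] s t ge sl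
    by (auto intro: continuous_intros)
  have z'b: "z' \<in> {0..b}" using z'(1,2) t s by auto
  have "z' < s" using z'(2,3) sl by (cases "z' = s") auto
  have "U a z' = 1" using U_eq_1_iff[OF a z'b] U_eq_1_iff[OF a z] z'(3) Uz by simp
  then obtain d' where d': "0 < d'" "\<And>t. t \<in> {0..b} \<Longrightarrow> z' < t \<Longrightarrow> t < z' + d' \<Longrightarrow> \<phi> a z' < \<phi> a t"
    using angle_near_crossing[OF a z'b] by metis
  define r where "r = min (z' + d' / 2) s"
  have "z' < r" "r < z' + d'" "r \<le> s" using d'(1) \<open>z' < s\<close> by (auto simp: r_def)
  then show False using d'(2)[of r] z'(3) z'(4)[of r] z'b s t by force
qed

lemma angle_after_crossing:
  assumes a: "a \<in> {0<..<1}" and t: "0 \<le> z" "z < t" "t \<le> b" and Uz: "U a z = 1"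
  shows "\<phi> a z < \<phi> a t"
proof (rule ccontr)
  assume le: "\<not> \<phi> a z < \<phi> a t"
  have z: "z \<in> {0..b}" using t by auto
  obtain d where d: "0 < d" "\<And>t. t \<in> {0..b} \<Longrightarrow> z < t \<Longrightarrow> t < z + d \<Longrightarrow> \<phi> a z < \<phi> a t"
    using angle_near_crossing[OF a z Uz] by metis
  define s where "s = min (z + d / 2) t"
  have s: "z < s" "s \<le> t" "s < z + d" using t d(1) by (auto simp: s_def)
  have "\<phi> a z < \<phi> a s" using d(2)[of s] s t by auto
  then obtain z' where z': "s \<le> z'" "z' \<le> t" "\<phi> a z' = \<phi> a z"
    using IVT2'[of "\<phi> a" t "\<phi> a z" s] cont_\<phi>_t[OF a, of "{s..t}"] s t le by auto
  have "U a z' = 1" using U_eq_1_iff[OF a, of z'] U_eq_1_iff[OF a z] z' Uz s t by simp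
  then show False using angle_before_crossing[OF a t(1), of z'] z' s t by simp
qed

text \<open>Successive crossings have strictly increasing angles among the zeros of the cosine,
  hence at least pi apart. Indices start at 0, so crossing number \<open>i\<close> has angle at
  least \<open>pi / 2 + real i * pi\<close>.\<close>

lemma angle_ge_crossings:
  assumes a: "a \<in> {0<..<1}" and s: "0 \<le> s" "0 < l" "s + real n * l \<le> b"
    and zero: "\<And>i. i < n \<Longrightarrow> \<exists>z\<in>{s + real i * l<..<s + real (Suc i) * l}. U a z = 1"
  shows "i < n \<Longrightarrow> z \<in> {s + real i * l<..<s + real (Suc i) * l} \<Longrightarrow> U a z = 1 \<Longrightarrow>
    pi / 2 + real i * pi \<le> \<phi> a z"
proof (induction i arbitrary: z)
  case 0
  have "1 * l \<le> real n * l" using 0 s by (intro mult_right_mono) auto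
  moreover have "s < z" "z < s + l" using 0 by auto
  ultimately have z: "0 < z" "z \<le> b" using s by linarith+
  then have "0 < \<phi> a z" using angle_before_crossing[OF a, of 0 z] \<phi>_0[OF a] 0 by simp
  moreover have "cos (\<phi> a z) = 0" using U_eq_1_iff[OF a, of z] z 0 by simp
  ultimately show ?case using cos_zero_jump[of "\<phi> a z" 0] pi_gt_zero by simp
next
  case (Suc i)
  obtain z' where z': "z' \<in> {s + real i * l<..<s + real (Suc i) * l}" "U a z' = 1"
    using zero[of i] Suc.prems by auto
  have "real (Suc (Suc i)) * l \<le> real n * l" using Suc.prems s by (intro mult_right_mono) auto
  moreover have "z < s + real (Suc (Suc i)) * l" using Suc.prems by auto
  ultimately have z: "z \<le> b" using s by linarith
  have "0 \<le> real i * l" using s by simp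
  moreover have "s + real i * l < z'" "z' < s + real (Suc i) * l" "s + real (Suc i) * l < z"
    using z'(1) Suc.prems by auto
  ultimately have z0: "0 \<le> z'" "z' < z" using s by linarith+
  have "\<phi> a z' < \<phi> a z" by (rule angle_before_crossing[OF a z0 z]) (use Suc.prems in auto)
  moreover have "pi / 2 + real i * pi \<le> \<phi> a z'" using Suc.IH[OF _ z'] Suc.prems by simp
  moreover have "cos (\<phi> a z) = 0" using U_eq_1_iff[OF a, of z] z z0 Suc.prems by simp
  ultimately show ?case using cos_zero_jump[of "\<phi> a z" "Suc i"] by (simp add: algebra_simps)
qed

end

section \<open>Counting crossings\<close>

context cap
begin

lemma sin_product_pos: "0 < sin (2 * b) * sin (pi / 4)"
proof -
  have "0 < sin (pi / 4 :: real)" by (rule sin_gt_zero) auto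
  then show ?thesis using sin_double_pos[of b] b pi_gt_zero by (intro mult_pos_pos) auto
qed

text \<open>\<open>mid\<close> is the overview's theta_0. \<open>start\<close> keeps a distance from
  pi/4, so that the energy growth on \<open>[start, mid]\<close> has a positive lower rate.\<close>

definition mid :: real where "mid = (pi / 4 + b) / 2"
definition start :: real where "start = (pi / 4 + mid) / 2"
text \<open>The length for which \<open>2k + 2\<close> consecutive intervals fit both into
  \<open>[pi/8, pi/4]\<close>, used for \<open>a = 1/2\<close>, and into
  \<open>[start, mid]\<close>, used for the energy gain.\<close>

definition step :: "nat \<Rightarrow> real" where "step k = min (pi / 8) (mid - start) / real (2 * k + 2)"
text \<open>\<open>sin(2b) sin(pi/4)\<close> bounds \<open>sin(2t)\<close> from below on
  \<open>[pi/8, b]\<close>; thus \<open>\<mu> * rho k\<close> is the size parameter of the excursion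
  lemma for an interval of length \<open>step k\<close>.\<close>

definition rho :: "nat \<Rightarrow> real" where "rho k = sin (2 * b) * sin (pi / 4) * (step k)\<^sup>2"
text \<open>A lower bound for \<open>- cos(2t)/sin(2t)\<close> on \<open>[start, b]\<close>, half
  the coefficient of \<open>V^2\<close> in the energy growth.\<close>

definition kappa :: real where "kappa = - cos (2 * start)"

lemma mid_start: "pi / 4 < start" "start < mid" "mid < b"
proof -
  have m: "mid = pi / 8 + b / 2" by (simp add: mid_def field_simps)
  then have s: "start = 3 * pi / 16 + b / 4" by (simp add: start_def field_simps)
  show "pi / 4 < start" "start < mid" "mid < b" unfolding s m using b by simp_all
qed

lemma step_pos: "0 < step k"
  using mid_start pi_gt_zero by (auto simp: step_def intro!: divide_pos_pos)

lemma rho_pos: "0 < rho k"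
  unfolding rho_def using step_pos[of k] by (intro mult_pos_pos[OF sin_product_pos]) simp

lemma kappa_pos: "0 < kappa"
proof -
  have "0 < cos (pi - 2 * start)" using mid_start b by (intro cos_gt_zero) auto
  then show ?thesis by (simp add: kappa_def)
qed

lemma steps_fit: "n \<le> 2 * k + 2 \<Longrightarrow> real n * step k \<le> pi / 8" "n \<le> 2 * k + 2 \<Longrightarrow> real n * step k \<le> mid - start"
proof -
  assume n: "n \<le> 2 * k + 2"
  have "real n * step k \<le> real (2 * k + 2) * step k"
    using n step_pos[of k] by (intro mult_right_mono) auto
  also have "\<dots> = min (pi / 8) (mid - start)" unfolding step_def by simp
  finally show "real n * step k \<le> pi / 8" "real n * step k \<le> mid - start" by auto
qed

end

context shooting_angle
begin

lemma U_gap: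
  assumes a: "a \<in> {0<..<1}" and st: "pi / 8 \<le> s" "s < t" "t \<le> b"
    and pos: "\<And>r. r \<in> {s..t} \<Longrightarrow> 0 < U a r" and ne: "\<And>r. r \<in> {s<..<t} \<Longrightarrow> U a r \<noteq> 1"
    and long: "128 < \<mu> * (sin (2 * b) * sin (pi / 4)) * (t - s)\<^sup>2"
  shows "U a ((s + t) / 2) * (\<mu> * (sin (2 * b) * sin (pi / 4)) * (t - s)\<^sup>2) \<le> 64"
proof (rule excursion_midpoint_small[where p = "\<lambda>t. sin (2 * t)" and z = "V a"])
  have s0: "0 < s" using st pi_gt_zero by linarith
  show "0 < sin (2 * b) * sin (pi / 4)" by (rule sin_product_pos)
  fix x assume x: "x \<in> {s..t}"
  have xb: "x \<in> {0..b}" using x s0 st by auto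
  have sub: "{s..t} \<subseteq> {0..b}" using s0 st by auto
  show "(U a has_real_derivative V a x) (at x within {s..t})"
    by (rule DERIV_subset[OF DU[OF xb] sub])
  have "U a x \<le> M" using U_less_M[OF a xb] by simp
  then have "reaction M (U a x) = U a x - U a x ^ 5"
    using pos[OF x] by (simp add: reaction_def min_def max_def)
  then show "((\<lambda>x. sin (2 * x) * V a x) has_real_derivative \<mu> * sin (2 * x) * (U a x - U a x ^ 5))
      (at x within {s..t})"
    using DERIV_subset[OF DP[OF xb] sub, of a] by (simp add: mult_ac)
  show "sin (2 * b) * sin (pi / 4) \<le> sin (2 * x) \<and> sin (2 * x) \<le> 1"
    using sin_double_ge_mult[of "pi / 8" x] x st by simp
qed (use st mu pos ne long in auto)

text \<open>The threshold 1024 exceeds the 128 that \<open>U_gap\<close> asks for, and it turns the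
  second alternative into a height of at most 64/1024 = 1/16.\<close>

lemma crossing_or_small:
  assumes a: "a \<in> {0<..<1}" and s: "pi / 8 \<le> s" "s + step k \<le> b"
    and pos: "\<And>r. r \<in> {s..s + step k} \<Longrightarrow> 0 < U a r"
    and big: "1024 \<le> \<mu> * rho k"
  shows "(\<exists>z\<in>{s<..<s + step k}. U a z = 1) \<or> U a (s + step k / 2) * (\<mu> * rho k) \<le> 64"
proof (rule disjCI)
  assume no: "\<not> U a (s + step k / 2) * (\<mu> * rho k) \<le> 64"
  show "\<exists>z\<in>{s<..<s + step k}. U a z = 1"
  proof (rule ccontr)
    assume "\<not> ?thesis"
    then have "U a ((s + (s + step k)) / 2) * (\<mu> * (sin (2 * b) * sin (pi / 4)) * (s + step k - s)\<^sup>2) \<le> 64"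
      by (intro U_gap[OF a]) (use s pos big step_pos[of k] in \<open>auto simp: rho_def mult.assoc\<close>)
    then show False using no by (simp add: rho_def field_simps)
  qed
qed

text \<open>Up to pi/4 the energy stays below its initial value, at most \<open>- \<mu> / 9\<close>,
  which keeps \<open>U\<close> away from 0: height at most 1/16 would give potential at least
  -1/512. So all \<open>2k + 2\<close> intervals in \<open>[pi/8, pi/4]\<close> contain a crossing,
  the last with index \<open>2k + 1\<close>.\<close>

lemma many_crossings_from_half:
  assumes big: "1024 \<le> \<mu> * rho k" and t: "pi / 4 \<le> t" "t \<le> b"
  shows "pi / 2 + real (2 * k + 1) * pi \<le> \<phi> (1 / 2) t"
proof -
  let ?a = "1 / 2 :: real"
  have a: "?a \<in> {0<..<1}" by simp
  have E0: "energy ?a 0 \<le> - \<mu> / 9"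
  proof -
    have "potential ?a \<le> - 1 / 9" by (simp add: potential_def power_divide)
    then show ?thesis unfolding energy_0 using mult_left_mono[of "potential ?a" "- 1 / 9" \<mu>] mu by simp
  qed
  have E: "\<mu> * potential (U ?a r) \<le> - \<mu> / 9" if r: "0 \<le> r" "r \<le> pi / 4" for r
  proof -
    have "energy ?a r \<le> energy ?a 0"
      by (rule energy_decreasing) (use r U_less_M[OF a] b in \<open>auto intro: less_imp_le\<close>)
    then show ?thesis using E0 energy_ge[of ?a r] by linarith
  qed
  have pot: "potential (U ?a r) \<le> - 1 / 9" if r: "0 \<le> r" "r \<le> pi / 4" for r
  proof -
    have "\<mu> * potential (U ?a r) \<le> \<mu> * (- 1 / 9)" using E[OF r] by simp
    then show ?thesis using mu by (simp only: mult_le_cancel_left_pos)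
  qed
  have pos: "0 < U ?a r" if r: "0 \<le> r" "r \<le> pi / 4" for r
  proof (rule ccontr)
    assume "\<not> 0 < U ?a r"
    then have "potential (U ?a r) = 0" by (simp add: potential_def max_absorb1)
    then show False using pot[OF r] by simp
  qed
  define n where "n = 2 * k + 2"
  have fit: "real i * step k \<le> pi / 8" if "i \<le> n" for i using steps_fit(1)[of i k] that by (simp add: n_def)
  have zero: "\<exists>z\<in>{pi / 8 + real i * step k<..<pi / 8 + real (Suc i) * step k}. U ?a z = 1" if i: "i < n" for i
  proof -
    define s where "s = pi / 8 + real i * step k"
    have Suc: "pi / 8 + real (Suc i) * step k = s + step k" by (simp add: s_def algebra_simps)
    have s: "pi / 8 \<le> s" "s + step k \<le> pi / 4"
      using step_pos[of k] fit[of "Suc i"] i unfolding Suc[symmetric] by (auto simp: s_def)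
    have s0: "0 < s" using s pi_gt_zero by linarith
    have "(\<exists>z\<in>{s<..<s + step k}. U ?a z = 1) \<or> U ?a (s + step k / 2) * (\<mu> * rho k) \<le> 64"
      by (rule crossing_or_small[OF a _ _ _ big]) (use s s0 b pos in auto)
    moreover have "\<not> U ?a (s + step k / 2) * (\<mu> * rho k) \<le> 64"
    proof
      define u where "u = U ?a (s + step k / 2)"
      have sm: "0 \<le> s + step k / 2" "s + step k / 2 \<le> pi / 4" using s s0 step_pos[of k] by auto
      have u0: "0 < u" unfolding u_def by (rule pos[OF sm])
      assume "U ?a (s + step k / 2) * (\<mu> * rho k) \<le> 64"
      moreover have "u * 1024 \<le> u * (\<mu> * rho k)" using u0 big by (intro mult_left_mono) auto
      ultimately have "u \<le> 1 / 16" unfolding u_def[symmetric] by linarith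
      then have "u\<^sup>2 \<le> (1 / 16)\<^sup>2" using u0 by (intro power_mono) auto
      then have "u\<^sup>2 \<le> 1 / 256" by (simp add: power2_eq_square)
      moreover have "- (u\<^sup>2) / 2 \<le> potential u" using potential_ge_square[of u] u0 by (simp add: max_def)
      ultimately show False using pot[OF sm] unfolding u_def[symmetric] by linarith
    qed
    ultimately show ?thesis unfolding Suc s_def[symmetric] by blast
  qed
  have fitn: "pi / 8 + real n * step k \<le> b" using fit[of n] b by linarith
  obtain z where z: "z \<in> {pi / 8 + real (2 * k + 1) * step k<..<pi / 8 + real (Suc (2 * k + 1)) * step k}" "U ?a z = 1"
    using zero[of "2 * k + 1"] by (auto simp: n_def)
  have "pi / 2 + real (2 * k + 1) * pi \<le> \<phi> ?a z"
    by (rule angle_ge_crossings[OF a _ step_pos fitn zero _ z]) (auto simp: n_def)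
  moreover have "\<phi> ?a z < \<phi> ?a t"
  proof (rule angle_after_crossing[OF a _ _ t(2) z(2)])
    have "z < pi / 8 + real (Suc (2 * k + 1)) * step k" "pi / 8 + real (2 * k + 1) * step k < z" using z(1) by auto
    moreover have "0 \<le> real (2 * k + 1) * step k" using step_pos[of k] by simp
    ultimately show "z < t" "0 \<le> z" using fit[of "Suc (2 * k + 1)"] t pi_gt_zero unfolding n_def by linarith+
  qed
  ultimately show ?thesis by linarith
qed

text \<open>The orbit of \<open>a = 0\<close> is identically 0. By uniform continuity nearby orbits
  stay below 1, so their angle never reaches pi/2.\<close>

lemma small_start:
  obtains a0 where "0 < a0" "a0 < 1 / 2" "\<And>t. t \<in> {0..b} \<Longrightarrow> \<phi> a0 t < pi / 2"
proof -
  have "uniformly_continuous_on ({0..1} \<times> {0..b}) (\<lambda>(a, t). U a t)"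
    by (rule compact_uniformly_continuous) (auto intro: continuous_on_subset[OF contU] compact_Times)
  then obtain d where d: "0 < d" "\<And>x y. x \<in> {0..1} \<times> {0..b} \<Longrightarrow> y \<in> {0..1} \<times> {0..b} \<Longrightarrow> dist y x < d \<Longrightarrow>
      dist (case y of (a, t) \<Rightarrow> U a t) (case x of (a, t) \<Rightarrow> U a t) < 1"
    unfolding uniformly_continuous_on_def by (metis zero_less_one)
  define a0 where "a0 = min (d / 2) (1 / 4)"
  have a0: "0 < a0" "a0 < 1 / 2" "a0 < d" "a0 \<in> {0<..<1}" using d(1) by (auto simp: a0_def)
  have U1: "U a0 t < 1" if t: "t \<in> {0..b}" for t
  proof -
    have "dist (a0, t) (0, t) < d" using a0 by (simp add: dist_Pair_Pair)
    then have "dist (U a0 t) (U 0 t) < 1" using d(2)[of "(0, t)" "(a0, t)"] t a0 by auto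
    then show ?thesis using Uz[OF t] by (simp add: dist_real_def)
  qed
  have "\<phi> a0 t < pi / 2" if t: "t \<in> {0..b}" for t
  proof (rule ccontr)
    assume "\<not> ?thesis"
    then obtain s where s: "0 \<le> s" "s \<le> t" "\<phi> a0 s = pi / 2"
      using IVT'[of "\<phi> a0" 0 "pi / 2" t] cont_\<phi>_t[OF a0(4), of "{0..t}"] \<phi>_0[OF a0(4)] t pi_gt_zero by auto
    have "cos (\<phi> a0 s) = 0" unfolding s(3) by simp
    then have "U a0 s = 1" using U_eq_1_iff[OF a0(4), of s] s(1,2) t by simp
    then show False using U1[of s] s t by simp
  qed
  then show thesis using that a0 by blast
qed

text \<open>Some interval in \<open>[start, mid]\<close> has no crossing, so \<open>U\<close> is
  tiny at its midpoint \<open>c\<close> and the energy there is at least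
  \<open>- kappa sqrt \<mu> / 8\<close>. Climbing from 1/4 to 1 adds
  \<open>kappa sqrt \<mu> / 4\<close>; half of it survives.\<close>

lemma energy_after_crossings:
  assumes a: "a \<in> {0<..<1}" and big: "1024 \<le> \<mu> * rho k" "1 \<le> \<mu>" "16384 \<le> \<mu> * kappa * (rho k)\<^sup>2"
    and mid: "U a mid = 1" and angle: "\<phi> a mid < pi / 2 + real (2 * k) * pi"
  shows "kappa * sqrt \<mu> / 8 \<le> energy a mid"
proof -
  note ms = mid_start
  have s0: "0 < start" using ms pi_gt_zero by linarith
  \<comment> \<open>A nonpositive value could not be followed by \<open>U a mid = 1\<close>.\<close>
  have pos: "0 < U a r" if r: "r \<in> {0..mid}" for r
    using U_negative_after_zero[OF a, of r mid] r ms mid by (cases "r = mid") force+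
  define n where "n = 2 * k + 1"
  have fit: "start + real i * step k \<le> mid" if "i \<le> n" for i
    using steps_fit(2)[of i k] that by (simp add: n_def)
  \<comment> \<open>A crossing in each of the \<open>2k + 1\<close> intervals would push the angle
    beyond \<open>pi / 2 + 2 k pi\<close> before \<open>mid\<close>.\<close>
  have "\<exists>i<n. \<not> (\<exists>z\<in>{start + real i * step k<..<start + real (Suc i) * step k}. U a z = 1)"
  proof (rule ccontr)
    assume "\<not> ?thesis"
    then have zero: "\<And>i. i < n \<Longrightarrow> \<exists>z\<in>{start + real i * step k<..<start + real (Suc i) * step k}. U a z = 1"
      by blast
    obtain z where z: "z \<in> {start + real (2 * k) * step k<..<start + real (Suc (2 * k)) * step k}" "U a z = 1"
      using zero[of "2 * k"] by (auto simp: n_def)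
    have zm: "z < mid" "0 \<le> z"
    proof -
      have "z < start + real (Suc (2 * k)) * step k" "start + real (2 * k) * step k < z" using z(1) by auto
      moreover have "0 \<le> real (2 * k) * step k" using step_pos[of k] by simp
      ultimately show "z < mid" "0 \<le> z" using fit[of "Suc (2 * k)"] s0 unfolding n_def by auto
    qed
    have "pi / 2 + real (2 * k) * pi \<le> \<phi> a z"
      by (rule angle_ge_crossings[OF a _ step_pos _ zero _ z]) (use s0 fit[of n] ms in \<open>auto simp: n_def\<close>)
    moreover have "\<phi> a z < \<phi> a mid" by (rule angle_after_crossing[OF a zm(2,1) _ z(2)]) (use ms in simp)
    ultimately show False using angle by linarith
  qed
  then obtain i where i: "i < n" "\<not> (\<exists>z\<in>{start + real i * step k<..<start + real (Suc i) * step k}. U a z = 1)"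
    by blast
  define s where "s = start + real i * step k"
  have Suc: "start + real (Suc i) * step k = s + step k" by (simp add: s_def algebra_simps)
  have s: "start \<le> s" "s + step k \<le> mid"
    using step_pos[of k] fit[of "Suc i"] i(1) unfolding Suc[symmetric] by (auto simp: s_def)
  define c where "c = s + step k / 2"
  have c: "start < c" "c < mid" using s step_pos[of k] by (auto simp: c_def)
  have "U a c * (\<mu> * rho k) \<le> 64"
    using crossing_or_small[OF a _ _ _ big(1), of s] i(2) s s0 ms pos pi_gt_zero
    unfolding Suc s_def[symmetric] c_def by force
  define u where "u = U a c"
  have u0: "0 < u" unfolding u_def using pos c s0 by auto
  have small: "u * (\<mu> * rho k) \<le> 64" unfolding u_def by fact
  have "u * 1024 \<le> u * (\<mu> * rho k)" using u0 big by (intro mult_left_mono) auto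
  then have u16: "u \<le> 1 / 16" using small by linarith
  have Ec: "- (\<mu> * u\<^sup>2 / 2) \<le> energy a c"
  proof -
    have "\<mu> * (- (u\<^sup>2) / 2) \<le> \<mu> * potential u"
      using potential_ge_square[of u] u0 mu by (intro mult_left_mono) (auto simp: max_def)
    then show ?thesis using energy_ge[of a c] by (simp add: u_def)
  qed
  have UM: "U a r \<le> M" if "r \<in> {0..b}" for r using U_less_M[OF a that] by simp
  have Einc: "energy a r \<le> energy a r'" if "start \<le> r" "r \<le> r'" "r' \<le> b" for r r'
    by (rule energy_increasing) (use that ms s0 UM in auto)
  obtain \<beta> where \<beta>: "c \<le> \<beta>" "\<beta> \<le> mid" "U a \<beta> = 1" "\<And>r. c \<le> r \<Longrightarrow> r < \<beta> \<Longrightarrow> U a r < 1"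
    using first_hit[of c mid "U a" 1] cont_t(1)[of "{c..mid}" a] c s0 ms mid u16 by (auto simp: u_def)
  obtain \<alpha> where \<alpha>: "c \<le> \<alpha>" "\<alpha> \<le> \<beta>" "U a \<alpha> = 1 / 4" "\<And>r. \<alpha> < r \<Longrightarrow> r \<le> \<beta> \<Longrightarrow> 1 / 4 < U a r"
    using last_hit[of c \<beta> "U a" "1 / 4"] cont_t(1)[of "{c..\<beta>}" a] c s0 ms \<beta> u16 by (auto simp: u_def)
  \<comment> \<open>The energy is at least \<open>- \<mu>/512\<close> since
    \<open>u <= 1/16\<close>, the potential part at most \<open>- \<mu>/48\<close>; twice the
    difference exceeds \<open>\<mu>/36\<close>.\<close>
  have speed: "sqrt \<mu> / 6 \<le> \<bar>V a r\<bar>" if r: "\<alpha> < r" "r < \<beta>" for r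
  proof -
    have Ur: "1 / 4 < U a r" "U a r < 1" using \<alpha>(1) \<alpha>(4)[of r] \<beta>(4)[of r] r by auto
    have "(1 / 4)\<^sup>2 \<le> (U a r)\<^sup>2" using Ur by (intro power_mono) auto
    then have "1 / 16 \<le> (U a r)\<^sup>2" by (simp add: power2_eq_square)
    moreover have "potential (U a r) \<le> - ((U a r)\<^sup>2) / 3"
      using potential_nonpos[of "U a r"] Ur by (simp add: max_def)
    ultimately have "potential (U a r) \<le> - 1 / 48" by linarith
    then have 1: "\<mu> * potential (U a r) \<le> \<mu> * (- 1 / 48)" using mu by (intro mult_left_mono) auto
    have "u\<^sup>2 \<le> (1 / 16)\<^sup>2" using u0 u16 by (intro power_mono) auto
    then have "u\<^sup>2 \<le> 1 / 256" by (simp add: power2_eq_square)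
    then have "\<mu> * u\<^sup>2 \<le> \<mu> * (1 / 256)" using mu by (intro mult_left_mono) auto
    moreover have "energy a c \<le> energy a r" by (rule Einc) (use c \<alpha> \<beta> r ms in auto)
    ultimately have "\<mu> / 36 \<le> (V a r)\<^sup>2"
      using Ec 1 mu unfolding energy_def[of a r] by linarith
    moreover have "(sqrt \<mu> / 6)\<^sup>2 = \<mu> / 36" using mu by (simp add: power_divide)
    ultimately have "(sqrt \<mu> / 6)\<^sup>2 \<le> \<bar>V a r\<bar>\<^sup>2" by simp
    then show ?thesis by (rule power2_le_imp_le) simp
  qed
  \<comment> \<open>\<open>energy' >= 2 kappa V^2 >= m V\<close> by the speed bound, whatever the
    sign of \<open>V\<close>. Comparing with \<open>m U\<close> integrates this without knowing how
    long the climb takes; the total rise of \<open>U\<close> is 3/4.\<close>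
  define m where "m = kappa * sqrt \<mu> / 3"
  have "energy a \<alpha> - m * U a \<alpha> \<le> energy a \<beta> - m * U a \<beta>"
  proof (rule DERIV_nonneg_imp_increasing_open[where f = "\<lambda>r. energy a r - m * U a r", OF \<alpha>(2)])
    fix r assume r: "\<alpha> < r" "r < \<beta>"
    have rb: "0 < r" "r < b" "start < r" using r \<alpha> \<beta> c s0 ms by auto
    have sr: "0 < sin (2 * r)" "sin (2 * r) \<le> 1" using sin_double_pos[of r] rb by auto
    have "cos (pi - 2 * start) \<le> cos (pi - 2 * r)"
      using rb ms b by (intro cos_monotone_0_pi_le) auto
    then have k: "kappa \<le> - cos (2 * r)" by (simp add: kappa_def)
    have "kappa * 1 \<le> - cos (2 * r) * (1 / sin (2 * r))"
      using k kappa_pos sr by (intro mult_mono) auto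
    then have k': "kappa \<le> - (cos (2 * r) / sin (2 * r))" by simp
    have "V a r * (sqrt \<mu> / 6) \<le> \<bar>V a r\<bar> * \<bar>V a r\<bar>"
      using speed[OF r] mu by (intro mult_mono) auto
    then have "kappa * (V a r * (sqrt \<mu> / 6)) \<le> kappa * (V a r)\<^sup>2"
      using kappa_pos by (intro mult_left_mono) (auto simp: power2_eq_square)
    also have "\<dots> \<le> - (cos (2 * r) / sin (2 * r)) * (V a r)\<^sup>2"
      using k' by (intro mult_right_mono) auto
    finally have "2 * (kappa * (V a r * (sqrt \<mu> / 6))) \<le> 2 * (- (cos (2 * r) / sin (2 * r)) * (V a r)\<^sup>2)"
      by (rule mult_left_mono) simp
    moreover have "2 * (kappa * (V a r * (sqrt \<mu> / 6))) = m * V a r" by (simp add: m_def)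
    moreover have "2 * (- (cos (2 * r) / sin (2 * r)) * (V a r)\<^sup>2) = - 2 * (cos (2 * r) / sin (2 * r)) * (V a r)\<^sup>2"
      by simp
    ultimately have "m * V a r \<le> - 2 * (cos (2 * r) / sin (2 * r)) * (V a r)\<^sup>2" by (simp only:)
    moreover have "((\<lambda>r. energy a r - m * U a r) has_real_derivative
        - 2 * (cos (2 * r) / sin (2 * r)) * (V a r)\<^sup>2 - m * V a r) (at r)"
      using rb UM by (intro DERIV_diff DERIV_cmult DERIV_energy DERIV_U) auto
    ultimately show "\<exists>y. ((\<lambda>r. energy a r - m * U a r) has_real_derivative y) (at r) \<and> 0 \<le> y"
      by (intro exI[of _ "- 2 * (cos (2 * r) / sin (2 * r)) * (V a r)\<^sup>2 - m * V a r"]) auto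
  next
    show "continuous_on {\<alpha>..\<beta>} (\<lambda>r. energy a r - m * U a r)"
      using \<alpha> \<beta> c s0 ms by (intro continuous_intros cont_energy cont_t) auto
  qed
  then have "energy a \<alpha> + kappa * sqrt \<mu> / 4 \<le> energy a \<beta>"
    using \<alpha>(3) \<beta>(3) by (simp add: m_def)
  moreover have "energy a c \<le> energy a \<alpha>" by (rule Einc) (use c \<alpha> \<beta> ms in auto)
  moreover have "energy a \<beta> \<le> energy a mid" by (rule Einc) (use c \<alpha> \<beta> ms in auto)
  \<comment> \<open>Squaring the smallness bound gives 64^2 / 2 = 2048, and 16384 = 8 * 2048 in the
    hypothesis.\<close>
  moreover have "\<mu> * u\<^sup>2 / 2 \<le> kappa * sqrt \<mu> / 8"
  proof -
    have "(u * (\<mu> * rho k))\<^sup>2 \<le> 64\<^sup>2" using small u0 mu rho_pos[of k] by (intro power_mono) auto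
    then have "(\<mu> * u\<^sup>2 / 2) * (\<mu> * (rho k)\<^sup>2) \<le> 2048" by (simp add: power2_eq_square mult_ac)
    also have "2048 \<le> kappa / 8 * (\<mu> * (rho k)\<^sup>2)" using big(3) by (simp add: mult_ac)
    finally have "\<mu> * u\<^sup>2 / 2 \<le> kappa / 8"
      using mu rho_pos[of k] by (simp only: mult_le_cancel_right_pos mult_pos_pos zero_less_power)
    moreover have "kappa / 8 * 1 \<le> kappa / 8 * sqrt \<mu>" using kappa_pos big(2) by (intro mult_left_mono) auto
    ultimately show ?thesis by simp
  qed
  ultimately show ?thesis using Ec by linarith
qed

text \<open>While \<open>U <= 1\<close> the potential is nonpositive and the energy does not drop,
  so \<open>V^2 >= 2 e\<close>. Hence \<open>V\<close> cannot turn, \<open>U\<close> falls at least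
  at speed \<open>sqrt (2 e)\<close>, and the time \<open>b - t0\<close> suffices for a drop of more
  than 1.\<close>

lemma descent_to_negative:
  assumes a: "a \<in> {0<..<1}" and t0: "pi / 4 \<le> t0" "t0 < b" and U: "U a t0 = 1" and V: "V a t0 < 0"
    and e: "0 < e" "e \<le> energy a t0" "1 < 2 * e * (b - t0)\<^sup>2"
  shows "U a b < 0" and "\<And>r. t0 < r \<Longrightarrow> r \<le> b \<Longrightarrow> U a r < 1"
proof -
  have t00: "0 < t0" using quarter_pos t0 by simp
  have UM: "U a r \<le> M" if "r \<in> {0..b}" for r using U_less_M[OF a that] by simp
  have le1: "U a r \<le> 1" if r: "t0 \<le> r" "r \<le> b" and Vn: "\<And>x. t0 \<le> x \<Longrightarrow> x < r \<Longrightarrow> V a x < 0" for r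
    unfolding U[symmetric]
  proof (rule DERIV_nonpos_imp_decreasing_open[OF r(1)])
    show "\<exists>y. (U a has_real_derivative y) (at x) \<and> y \<le> 0" if x: "t0 < x" "x < r" for x
      using DERIV_U[of x a] Vn[of x] x r t00 by fastforce
  qed (use r t00 in \<open>auto intro!: cont_t\<close>)
  have V2: "2 * e \<le> (V a r)\<^sup>2" if r: "t0 \<le> r" "r \<le> b" "U a r \<le> 1" for r
  proof -
    have "energy a t0 \<le> energy a r" by (rule energy_increasing) (use r t0 t00 UM in auto)
    moreover have "potential (U a r) \<le> 0"
      using potential_nonpos[OF r(3)] zero_le_power2[of "max 0 (U a r)"] by linarith
    then have "\<mu> * potential (U a r) \<le> 0" using mu by (simp add: mult_nonneg_nonpos)
    ultimately show ?thesis using e(2) unfolding energy_def[of a r] by linarith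
  qed
  have Vneg: "V a r < 0" if r: "t0 \<le> r" "r \<le> b" for r
  proof (rule ccontr)
    assume "\<not> V a r < 0"
    then obtain t1 where t1: "t0 \<le> t1" "t1 \<le> r" "V a t1 = 0" "\<And>x. t0 \<le> x \<Longrightarrow> x < t1 \<Longrightarrow> V a x < 0"
      using first_hit[of t0 r "V a" 0] cont_t(2)[of "{t0..r}" a] r t00 V by auto
    have "U a t1 \<le> 1" by (rule le1) (use t1 r in auto)
    then show False using V2[of t1] t1 r e(1) by simp
  qed
  have Vle: "V a r \<le> - sqrt (2 * e)" if r: "t0 \<le> r" "r \<le> b" for r
  proof -
    have "2 * e \<le> (- V a r)\<^sup>2" using V2[of r] le1[of r] Vneg r by simp
    then have "sqrt (2 * e) \<le> - V a r" using Vneg[OF r] by (intro real_le_lsqrt) auto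
    then show ?thesis by simp
  qed
  have line: "U a r + sqrt (2 * e) * r \<le> U a t0 + sqrt (2 * e) * t0" if r: "t0 \<le> r" "r \<le> b" for r
  proof (rule DERIV_nonpos_imp_decreasing_open[where f = "\<lambda>r. U a r + sqrt (2 * e) * r", OF r(1)])
    fix x assume x: "t0 < x" "x < r"
    show "\<exists>y. ((\<lambda>r. U a r + sqrt (2 * e) * r) has_real_derivative y) (at x) \<and> y \<le> 0"
      using DERIV_add[OF DERIV_U[of x a] DERIV_cmult_Id[of "sqrt (2 * e)" x]] Vle[of x] x r t00
      by (intro exI[of _ "V a x + sqrt (2 * e)"]) auto
  qed (use r t00 in \<open>auto intro!: cont_t continuous_intros\<close>)
  have e0: "0 < sqrt (2 * e)" using e by simp
  show "U a r < 1" if r: "t0 < r" "r \<le> b" for r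
  proof -
    have "sqrt (2 * e) * t0 < sqrt (2 * e) * r" using e0 r by simp
    then show ?thesis using line[of r] r U by linarith
  qed
  have "1\<^sup>2 < (sqrt (2 * e) * (b - t0))\<^sup>2" using e by (simp add: power_mult_distrib)
  then have "1 < sqrt (2 * e) * (b - t0)"
    by (rule power2_less_imp_less) (use e t0 in simp)
  then have "1 < sqrt (2 * e) * b - sqrt (2 * e) * t0" by (simp add: right_diff_distrib)
  then show "U a b < 0" using line[of b] t0 U by linarith
qed

text \<open>At \<open>B\<close> the value \<open>U B b\<close> is negative, while at both ends of
  the angle window around \<open>2 j pi\<close> it equals 1. Leaving the window towards
  \<open>a0\<close> and towards \<open>1/2\<close> therefore forces one zero on each side.\<close>

lemma zeros_with_spikes:
  assumes j: "1 \<le> j" "j \<le> k"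
    and big: "1024 \<le> \<mu> * rho k" "1 \<le> \<mu>" "16384 \<le> \<mu> * kappa * (rho k)\<^sup>2" "4 < kappa * sqrt \<mu> * (b - mid)\<^sup>2"
  obtains z1 z2 where "0 < z1" "z1 < z2" "z2 < 1" "U z1 b = 0" "U z2 b = 0"
    "\<bar>\<phi> z1 b - 2 * real j * pi\<bar> < pi / 2" "\<bar>\<phi> z2 b - 2 * real j * pi\<bar> < pi / 2"
proof -
  note ms = mid_start
  obtain a0 where a0: "0 < a0" "a0 < 1 / 2" "\<And>t. t \<in> {0..b} \<Longrightarrow> \<phi> a0 t < pi / 2"
    using small_start by blast
  have midb: "mid \<in> {0..b}" using ms quarter_pos[of mid] by auto
  have jpi: "1 * pi \<le> real j * pi" "real j * pi \<le> real k * pi" using j by (auto intro!: mult_right_mono)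
  have hi: "2 * real j * pi + pi / 2 \<le> \<phi> (1 / 2) t" if "pi / 4 \<le> t" "t \<le> b" for t
  proof -
    have "pi / 2 + real (2 * k + 1) * pi = pi / 2 + 2 * (real k * pi) + pi" by (simp add: algebra_simps)
    then show ?thesis using many_crossings_from_half[OF big(1) that] jpi pi_gt_zero by linarith
  qed
  have lo: "\<phi> a0 t < 2 * real j * pi - pi / 2" if "t \<in> {0..b}" for t
    using a0(3)[OF that] jpi pi_gt_zero by linarith
  \<comment> \<open>At this angle the cosine is 0 and the sine is -1: a crossing of 1 from above
    located exactly at \<open>mid\<close>.\<close>
  obtain B where B: "a0 \<le> B" "B \<le> 1 / 2" "\<phi> B mid = 2 * real j * pi - pi / 2"
  proof (rule exE[OF IVT'[of "\<lambda>a. \<phi> a mid" a0 "2 * real j * pi - pi / 2" "1 / 2"]])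
    show "\<phi> a0 mid \<le> 2 * real j * pi - pi / 2" using lo[OF midb] by simp
    have "2 * real j * pi + pi / 2 \<le> \<phi> (1 / 2) mid" using hi[of mid] ms by simp
    then show "2 * real j * pi - pi / 2 \<le> \<phi> (1 / 2) mid" using pi_gt_zero by linarith
    show "continuous_on {a0..1 / 2} (\<lambda>a. \<phi> a mid)" by (rule cont_\<phi>_a[OF _ midb]) (use a0 in auto)
  qed (use a0 that in auto)
  have B01: "B \<in> {0<..<1}" using B a0 by auto
  have turn: "sin (real j * (2 * pi)) = 0" "cos (real j * (2 * pi)) = 1"
    using sin_2npi[of j] cos_2npi[of j] by (simp_all add: mult_ac)
  have cs: "cos (\<phi> B mid) = 0" "sin (\<phi> B mid) = - 1"
  proof -
    have "cos (\<phi> B mid) = cos (real j * (2 * pi)) * cos (pi / 2) + sin (real j * (2 * pi)) * sin (pi / 2)"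
      unfolding B(3) cos_diff by (simp add: mult_ac)
    then show "cos (\<phi> B mid) = 0" using turn by simp
    have "sin (\<phi> B mid) = sin (real j * (2 * pi)) * cos (pi / 2) - cos (real j * (2 * pi)) * sin (pi / 2)"
      unfolding B(3) sin_diff by (simp add: mult_ac)
    then show "sin (\<phi> B mid) = - 1" using turn by simp
  qed
  have Um: "U B mid = 1" using U_eq_1_iff[OF B01 midb] cs by simp
  have Vm: "V B mid < 0" using polar[OF B01 midb] cs by auto
  have E: "kappa * sqrt \<mu> / 8 \<le> energy B mid"
  proof (rule energy_after_crossings[OF B01 big(1,2,3) Um])
    have "real (2 * k) * pi = 2 * (real k * pi)" by simp
    then show "\<phi> B mid < pi / 2 + real (2 * k) * pi" using B(3) jpi pi_gt_zero by linarith
  qed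
  have e0: "0 < kappa * sqrt \<mu> / 8" using kappa_pos mu by simp
  note D = descent_to_negative[OF B01 less_imp_le[OF less_trans[OF ms(1,2)]] ms(3) Um Vm e0 E]
  have 4: "1 < 2 * (kappa * sqrt \<mu> / 8) * (b - mid)\<^sup>2" using big(4) by (simp add: mult_ac)
  have bb: "b \<in> {0..b}" using b0 by simp
  have lower: "2 * real j * pi - pi / 2 < \<phi> B b"
    using angle_after_crossing[OF B01 _ ms(3) _ Um] midb B(3) by simp
  \<comment> \<open>Reaching the upper end of the window would be another crossing of 1, but after
    \<open>mid\<close> the orbit stays below 1.\<close>
  have upper: "\<phi> B b < 2 * real j * pi + pi / 2"
  proof (rule ccontr)
    assume "\<not> ?thesis"
    then obtain t where t: "mid \<le> t" "t \<le> b" "\<phi> B t = 2 * real j * pi + pi / 2"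
      using IVT'[of "\<phi> B" mid "2 * real j * pi + pi / 2" b] cont_\<phi>_t[OF B01, of "{mid..b}"] B(3) midb ms pi_gt_zero
      by auto
    have "cos (\<phi> B t) = cos (real j * (2 * pi)) * cos (pi / 2) - sin (real j * (2 * pi)) * sin (pi / 2)"
      unfolding t(3) cos_add by (simp add: mult_ac)
    then have "cos (\<phi> B t) = 0" using turn by simp
    then have "U B t = 1" using U_eq_1_iff[OF B01, of t] t midb by simp
    moreover have "t \<noteq> mid" using t(3) B(3) pi_gt_zero by auto
    ultimately show False using D(2)[OF 4, of t] t by simp
  qed
  define f where "f a = \<phi> a b - 2 * real j * pi" for a
  have fB: "\<bar>f B\<bar> < pi / 2"
    using lower upper unfolding f_def abs_less_iff by (intro conjI) linarith+
  have hit: "0 < U a b" if a: "a \<in> {0<..<1}" and "\<bar>f a\<bar> = pi / 2" for a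
  proof -
    have "cos (\<phi> a b) = cos (f a + real j * (2 * pi))" by (simp add: f_def mult_ac)
    also have "\<dots> = cos (f a)" unfolding cos_add turn by simp
    also have "\<dots> = cos \<bar>f a\<bar>" by (simp add: abs_if)
    also have "\<dots> = 0" by (simp only: that(2) cos_pi_half)
    finally show ?thesis using U_eq_1_iff[OF a bb] by simp
  qed
  have fc: "continuous_on {x..y} f" if "0 < x" "y < 1" for x y
    unfolding f_def using that by (intro continuous_intros cont_\<phi>_a bb) auto
  obtain z1 where z1: "a0 < z1" "z1 < B" "U z1 b = 0" "\<bar>f z1\<bar> < pi / 2"
    using trapped_zero_left[of a0 B f "\<lambda>a. U a b" "pi / 2"] B(1) a0 fc[of a0 B] B01 fB
      cont_a[OF bb] D(1)[OF 4] hit lo[OF bb] by (auto simp: f_def)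
  obtain z2 where z2: "B < z2" "z2 < 1 / 2" "U z2 b = 0" "\<bar>f z2\<bar> < pi / 2"
    using trapped_zero_right[of B "1 / 2" f "\<lambda>a. U a b" "pi / 2"] B(2) fc[of B "1 / 2"] B01 fB
      cont_a[OF bb] D(1)[OF 4] hit hi[of b] b by (auto simp: f_def)
  show thesis by (rule that[of z1 z2]) (use z1 z2 a0 in \<open>auto simp: f_def\<close>)
qed

text \<open>The windows of half-width pi/2 around the centres \<open>2 j pi\<close> are disjoint, so
  the pairs for different \<open>j\<close> share no element.\<close>

lemma many_zeros:
  assumes big: "1024 \<le> \<mu> * rho k" "1 \<le> \<mu>" "16384 \<le> \<mu> * kappa * (rho k)\<^sup>2" "4 < kappa * sqrt \<mu> * (b - mid)\<^sup>2"
  obtains Z where "finite Z" "card Z = 2 * k" "Z \<subseteq> {0<..<1}" "\<And>a. a \<in> Z \<Longrightarrow> U a b = 0"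
proof -
  have "\<forall>j\<in>{1..k}. \<exists>Z. finite Z \<and> card Z = 2 \<and> Z \<subseteq> {0<..<1} \<and>
      (\<forall>a\<in>Z. U a b = 0 \<and> \<bar>\<phi> a b - 2 * real j * pi\<bar> < pi / 2)"
  proof
    fix j assume "j \<in> {1..k}"
    then obtain z1 z2 where "0 < z1" "z1 < z2" "z2 < 1" "U z1 b = 0" "U z2 b = 0"
      "\<bar>\<phi> z1 b - 2 * real j * pi\<bar> < pi / 2" "\<bar>\<phi> z2 b - 2 * real j * pi\<bar> < pi / 2"
      using zeros_with_spikes[OF _ _ big] by auto
    then show "\<exists>Z. finite Z \<and> card Z = 2 \<and> Z \<subseteq> {0<..<1} \<and>
        (\<forall>a\<in>Z. U a b = 0 \<and> \<bar>\<phi> a b - 2 * real j * pi\<bar> < pi / 2)"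
      by (intro exI[of _ "{z1, z2}"]) auto
  qed
  then obtain Z where Z: "\<And>j. j \<in> {1..k} \<Longrightarrow> finite (Z j) \<and> card (Z j) = 2 \<and> Z j \<subseteq> {0<..<1} \<and>
      (\<forall>a\<in>Z j. U a b = 0 \<and> \<bar>\<phi> a b - 2 * real j * pi\<bar> < pi / 2)"
    by metis
  have disj: "Z i \<inter> Z j = {}" if ij: "i \<in> {1..k}" "j \<in> {1..k}" "i \<noteq> j" for i j
  proof (rule ccontr)
    assume "Z i \<inter> Z j \<noteq> {}"
    then obtain a where "a \<in> Z i" "a \<in> Z j" by auto
    then have "\<bar>\<phi> a b - 2 * real i * pi\<bar> < pi / 2" "\<bar>\<phi> a b - 2 * real j * pi\<bar> < pi / 2" using Z ij by auto
    then have "\<bar>2 * real i * pi - 2 * real j * pi\<bar> < pi" by linarith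
    moreover have "2 * real i * pi - 2 * real j * pi = 2 * (real i - real j) * pi" by (simp add: algebra_simps)
    ultimately have "\<bar>2 * (real i - real j)\<bar> * pi < 1 * pi" by (simp add: abs_mult)
    then have "\<bar>2 * (real i - real j)\<bar> < 1" by (simp only: mult_less_cancel_right_pos pi_gt_zero)
    then have "\<bar>real i - real j\<bar> < 1" by (simp add: abs_mult)
    then show False using ij(3) by (cases i j rule: linorder_cases) auto
  qed
  have "card (\<Union>j\<in>{1..k}. Z j) = (\<Sum>j\<in>{1..k}. card (Z j))"
    by (rule card_UN_disjoint) (use Z disj in auto)
  also have "\<dots> = 2 * k" using Z by simp
  finally have "card (\<Union>j\<in>{1..k}. Z j) = 2 * k" .
  moreover have "finite (\<Union>j\<in>{1..k}. Z j)" using Z by blast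
  moreover have "(\<Union>j\<in>{1..k}. Z j) \<subseteq> {0<..<1}" using Z by blast
  moreover have "\<And>a. a \<in> (\<Union>j\<in>{1..k}. Z j) \<Longrightarrow> U a b = 0" using Z by blast
  ultimately show thesis using that by blast
qed

end

section \<open>Classical solutions\<close>

context shooting
begin

text \<open>L'Hopital with denominator \<open>sin(t)^2\<close>, whose derivative
  \<open>sin(2t)\<close> is exactly the factor in the derivative of the flux. It controls
  \<open>V\<close> near the singular point to first order.\<close>

lemma flux_second_order: "((\<lambda>t. sin (2 * t) * V a t / (sin t)\<^sup>2) \<longlongrightarrow> \<mu> * reaction M a) (at_right 0)"
proof (rule lhopital_right)
  have lim: "(f \<longlongrightarrow> f 0) (at_right 0)" if "continuous_on {0..b} f" for f :: "real \<Rightarrow> real"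
    using that b0 by (auto simp: continuous_on simp flip: at_within_Icc_at_right[OF b0])
  have "((\<lambda>t. sin (2 * t) * V a t) \<longlongrightarrow> sin (2 * 0) * V a 0) (at_right 0)"
    by (rule lim) (intro continuous_intros cont_t order_refl)
  then show "((\<lambda>t. sin (2 * t) * V a t) \<longlongrightarrow> 0) (at_right 0)" by simp
  show "((\<lambda>t. (sin t)\<^sup>2 :: real) \<longlongrightarrow> 0) (at_right 0)" by (auto intro!: tendsto_eq_intros)
  have ev: "\<forall>\<^sub>F t in at_right 0. 0 < t \<and> t < b"
    unfolding eventually_at_right[OF b0] using b0 by blast
  show "\<forall>\<^sub>F t in at_right 0. (sin t)\<^sup>2 \<noteq> (0::real)"
    using ev
  proof eventually_elim
    case (elim t)
    then have "0 < sin t" using b by (intro sin_gt_zero) auto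
    then show ?case by simp
  qed
  show "\<forall>\<^sub>F t in at_right 0. sin (2 * t) \<noteq> (0::real)"
    using ev by eventually_elim (use sin_double_pos in force)
  show "\<forall>\<^sub>F t in at_right 0. ((\<lambda>t. sin (2 * t) * V a t) has_real_derivative
      sin (2 * t) * (\<mu> * reaction M (U a t))) (at t)"
    using ev
  proof eventually_elim
    case (elim t)
    then show ?case using DP[of t a] by (simp add: at_within_Icc_at)
  qed
  show "\<forall>\<^sub>F t in at_right 0. ((\<lambda>t. (sin t)\<^sup>2) has_real_derivative sin (2 * t)) (at t)"
    by (intro always_eventually allI) (auto intro!: derivative_eq_intros simp: sin_double)
  have "continuous_on {0..b} (\<lambda>t. \<mu> * reaction M (U a t))"
    unfolding reaction_def by (intro continuous_intros cont_t) auto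
  from lim[OF this] have L: "((\<lambda>t. \<mu> * reaction M (U a t)) \<longlongrightarrow> \<mu> * reaction M a) (at_right 0)"
    by (simp add: U0)
  show "((\<lambda>t. sin (2 * t) * (\<mu> * reaction M (U a t)) / sin (2 * t)) \<longlongrightarrow> \<mu> * reaction M a) (at_right 0)"
    by (rule Lim_transform_eventually[OF L]) (use ev in eventually_elim, use sin_double_pos in force)
qed

lemma classical_solution_restrict:
  assumes a: "a \<in> {0<..<1}" and Ub: "U a b = 0"
  shows "classical_solution (- \<mu>) b (restrict (U a) {0..b})"
proof -
  have pos: "0 < U a t" if "t \<in> {0..<b}" for t
    using U_negative_after_zero[OF a, of t b] that Ub by force
  have react: "reaction M (U a t) = U a t - U a t ^ 5" if t: "t \<in> {0..b}" for t
  proof -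
    have "0 \<le> U a t" using pos[of t] t Ub by (cases "t = b") auto
    then show ?thesis using U_less_M[OF a t] by (simp add: reaction_def max_def min_def)
  qed
  \<comment> \<open>Near 0 the term \<open>2 cos(2t)/sin(2t) V\<close> behaves like
    \<open>V / t\<close>, which tends to \<open>V'(0)\<close>; the equation then reads
    \<open>2 u''(0) = \<mu> reaction M a\<close>, whence the half.\<close>
  define w where "w t = (if t = 0 then \<mu> * reaction M a / 2
    else \<mu> * reaction M (U a t) - 2 * (cos (2 * t) / sin (2 * t)) * V a t)" for t
  have at0: "at 0 within {0..b} = at_right 0" by (rule at_within_Icc_at_right[OF b0])
  have sin1: "0 < sin t" "0 < cos t" if "0 < t" "t \<le> b" for t
    using that b by (auto intro!: sin_gt_zero cos_gt_zero)
  have ev: "\<forall>\<^sub>F t in at_right 0. 0 < t \<and> t < b"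
    unfolding eventually_at_right[OF b0] using b0 by blast
  have DV: "(V a has_real_derivative w t) (at t within {0..b})" if t: "t \<in> {0..b}" for t
  proof (cases "t = 0")
    case False
    then show ?thesis using DERIV_V_within[of t a] t by (simp add: w_def)
  next
    case True
    \<comment> \<open>\<open>V / t\<close> is split into the quotient of known limit and an
      elementary factor tending to 1/2; the same device serves for the continuity of
      \<open>w\<close> at 0.\<close>
    have "((\<lambda>t. sin (2 * t) * V a t / (sin t)\<^sup>2 * ((sin t)\<^sup>2 / (t * sin (2 * t)))) \<longlongrightarrow>
        \<mu> * reaction M a * (1 / 2)) (at_right 0)"
      by (intro tendsto_mult flux_second_order) real_asymp
    then have "((\<lambda>t. V a t / t) \<longlongrightarrow> \<mu> * reaction M a * (1 / 2)) (at_right 0)"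
    proof (rule Lim_transform_eventually)
      show "\<forall>\<^sub>F t in at_right 0. sin (2 * t) * V a t / (sin t)\<^sup>2 * ((sin t)\<^sup>2 / (t * sin (2 * t))) = V a t / t"
        using ev
      proof eventually_elim
        case (elim t)
        then show ?case using sin1[of t] sin_double_pos[of t] by simp
      qed
    qed
    then show ?thesis unfolding True at0 has_field_derivative_iff by (simp add: V0 w_def)
  qed
  have cw: "continuous_on {0..b} w"
  proof -
    have "continuous (at t within {0..b}) w" if t: "t \<in> {0..b}" for t
    proof (cases "t = 0")
      case True
      have "((\<lambda>t. \<mu> * reaction M (U a t)) \<longlongrightarrow> \<mu> * reaction M (U a 0)) (at 0 within {0..b})"
      proof -
        have "continuous_on {0..b} (\<lambda>t. \<mu> * reaction M (U a t))"
          unfolding reaction_def by (intro continuous_intros cont_t) auto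
        then show ?thesis using b0 by (auto simp: continuous_on)
      qed
      then have l1: "((\<lambda>t. \<mu> * reaction M (U a t)) \<longlongrightarrow> \<mu> * reaction M a) (at_right 0)"
        unfolding at0 by (simp add: U0)
      have l2: "((\<lambda>t. sin (2 * t) * V a t / (sin t)\<^sup>2 * (2 * cos (2 * t) * (sin t)\<^sup>2 / (sin (2 * t))\<^sup>2)) \<longlongrightarrow>
          \<mu> * reaction M a * (1 / 2)) (at_right 0)"
        by (intro tendsto_mult flux_second_order) real_asymp
      have "((\<lambda>t. \<mu> * reaction M (U a t) - sin (2 * t) * V a t / (sin t)\<^sup>2 * (2 * cos (2 * t) * (sin t)\<^sup>2 / (sin (2 * t))\<^sup>2))
          \<longlongrightarrow> \<mu> * reaction M a - \<mu> * reaction M a * (1 / 2)) (at_right 0)"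
        by (rule tendsto_diff[OF l1 l2])
      moreover have "\<forall>\<^sub>F t in at_right 0. \<mu> * reaction M (U a t) -
          sin (2 * t) * V a t / (sin t)\<^sup>2 * (2 * cos (2 * t) * (sin t)\<^sup>2 / (sin (2 * t))\<^sup>2) = w t"
        using ev
      proof eventually_elim
        case (elim t)
        then have "0 < sin t" "0 < sin (2 * t)" using sin1[of t] sin_double_pos[of t] by auto
        then show ?case using elim by (simp add: w_def power2_eq_square)
      qed
      ultimately have "(w \<longlongrightarrow> \<mu> * reaction M a - \<mu> * reaction M a * (1 / 2)) (at_right 0)"
        by (rule Lim_transform_eventually)
      moreover have "\<mu> * reaction M a - \<mu> * reaction M a * (1 / 2) = w 0" by (simp add: w_def)
      ultimately show ?thesis unfolding True continuous_within at0 by simp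
    next
      case False
      define g where "g t = \<mu> * reaction M (U a t) - 2 * (cos (2 * t) / sin (2 * t)) * V a t" for t
      have s: "sin (2 * t) \<noteq> 0" using sin_double_pos[of t] False t by auto
      have "continuous (at t within {0..b}) (U a)" "continuous (at t within {0..b}) (V a)"
        using cont_t[of "{0..b}" a] t by (auto simp: continuous_on_eq_continuous_within)
      then have "continuous (at t within {0..b}) g"
        unfolding g_def[abs_def] reaction_def using s by (intro continuous_intros) auto
      then show ?thesis
        by (rule continuous_transform_within[where \<delta> = t])
          (use t False in \<open>auto simp: g_def w_def dist_real_def\<close>)
    qed
    then show ?thesis by (simp add: continuous_on_eq_continuous_within)
  qed
  show ?thesis unfolding classical_solution_def
  proof (rule conjI, simp, rule exI[of _ "V a"], rule exI[of _ w], intro conjI ballI)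
    fix t assume t: "t \<in> {0..b}"
    show "(restrict (U a) {0..b} has_real_derivative V a t) (at t within {0..b})"
      by (rule has_field_derivative_transform_within[OF DU[OF t], of 1]) (use t in auto)
    show "(V a has_real_derivative w t) (at t within {0..b})" by (rule DV[OF t])
  next
    fix t assume t: "t \<in> {0<..<b}"
    then have "w t + 2 * (cos (2 * t) / sin (2 * t)) * V a t = \<mu> * (U a t - U a t ^ 5)"
      using react[of t] by (simp add: w_def)
    also have "\<dots> = - \<mu> * (restrict (U a) {0..b} t ^ 5 - restrict (U a) {0..b} t)"
      using t by (simp add: algebra_simps)
    finally show "w t + 2 * (cos (2 * t) / sin (2 * t)) * V a t =
        - \<mu> * (restrict (U a) {0..b} t ^ 5 - restrict (U a) {0..b} t)" .
    show "0 < restrict (U a) {0..b} t" using pos[of t] t by simp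
  qed (use cw V0 Ub b0 in auto)
qed

end

section \<open>The threshold for the parameter and the assembly of the solutions\<close>

lemma large_parameter:
  fixes r \<kappa> d :: real
  assumes "0 < r" "0 < \<kappa>" "0 < d"
  obtains A where "0 < A" "\<And>\<mu>. A < \<mu> \<Longrightarrow> 1024 \<le> \<mu> * r \<and> 1 \<le> \<mu> \<and> 16384 \<le> \<mu> * \<kappa> * r\<^sup>2 \<and> 4 < \<kappa> * sqrt \<mu> * d\<^sup>2"
proof -
  define A where "A = Max {1024 / r, 1, 16384 / (\<kappa> * r\<^sup>2), (4 / (\<kappa> * d\<^sup>2))\<^sup>2}"
  show thesis
  proof
    show "0 < A" unfolding A_def by (simp add: less_max_iff_disj)
    fix \<mu> assume "A < \<mu>"
    then have \<mu>: "1024 / r < \<mu>" "1 < \<mu>" "16384 / (\<kappa> * r\<^sup>2) < \<mu>" "(4 / (\<kappa> * d\<^sup>2))\<^sup>2 < \<mu>"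
      by (auto simp: A_def)
    have "4 / (\<kappa> * d\<^sup>2) < sqrt \<mu>" using \<mu>(4) by (rule real_less_rsqrt)
    then show "1024 \<le> \<mu> * r \<and> 1 \<le> \<mu> \<and> 16384 \<le> \<mu> * \<kappa> * r\<^sup>2 \<and> 4 < \<kappa> * sqrt \<mu> * d\<^sup>2"
      using \<mu> assms by (simp add: divide_less_eq mult_ac)
  qed
qed

theorem theorem1p3:
  fixes k :: nat and \<theta>\<^sub>1 :: real
  assumes "k \<ge> 1" and "\<theta>\<^sub>1 \<in> {pi / 4 <..< pi / 2}"
  shows "\<exists>A>0. \<forall>lam < - A. \<exists>S. finite S \<and> card S = 2 * k \<and>
           (\<forall>u\<in>S. classical_solution lam \<theta>\<^sub>1 u \<and> u 0 \<in> {0<..<1})"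
proof -
  define b where "b = \<theta>\<^sub>1"
  have b: "pi / 4 < b" "b < pi / 2" using assms by (auto simp: b_def)
  \<comment> \<open>This depends on \<open>b\<close> alone, so the truncation height is the same for
    all values of the parameter.\<close>
  define M where "M = 2 + 1 / (sin (2 * b))\<^sup>2"
  have M: "2 \<le> M" "1 / (sin (2 * b))\<^sup>2 < M" by (auto simp: M_def)
  interpret cap b by standard (use b in auto)
  obtain A where A: "0 < A" "\<And>\<mu>. A < \<mu> \<Longrightarrow> 1024 \<le> \<mu> * rho k \<and> 1 \<le> \<mu> \<and>
      16384 \<le> \<mu> * kappa * (rho k)\<^sup>2 \<and> 4 < kappa * sqrt \<mu> * (b - mid)\<^sup>2"
    using large_parameter[OF rho_pos kappa_pos] mid_start(3) by (metis diff_gt_0_iff_gt)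
  have "\<exists>S. finite S \<and> card S = 2 * k \<and> (\<forall>u\<in>S. classical_solution lam \<theta>\<^sub>1 u \<and> u 0 \<in> {0<..<1})"
    if lam: "lam < - A" for lam
  proof -
    define \<mu> where "\<mu> = - lam"
    have large: "A < \<mu>" "0 < \<mu>" using lam A(1) by (auto simp: \<mu>_def)
    have lip: "\<bar>\<mu> * reaction M x - \<mu> * reaction M y\<bar> \<le> (\<mu> * (1 + 5 * M ^ 4)) * \<bar>x - y\<bar>" for x y
    proof -
      have "\<bar>\<mu> * reaction M x - \<mu> * reaction M y\<bar> = \<mu> * \<bar>reaction M x - reaction M y\<bar>"
        using large(2) by (simp add: abs_mult flip: right_diff_distrib)
      also have "\<dots> \<le> \<mu> * ((1 + 5 * M ^ 4) * \<bar>x - y\<bar>)"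
        using large(2) M(1) by (intro mult_left_mono reaction_lipschitz) auto
      finally show ?thesis by (simp add: mult.assoc)
    qed
    have "\<mu> * reaction M 0 = 0" using M(1) by (simp add: reaction_def)
    with lip have "\<exists>U V. shooting b \<mu> M U V"
    proof (rule singular_ivp, goal_cases)
      case (1 U V)
      show ?case
        by (intro exI[of _ U] exI[of _ V], unfold_locales) (rule large M 1 | assumption)+
    qed
    then obtain U V where "shooting b \<mu> M U V" by blast
    then interpret shooting b \<mu> M U V .
    have "\<exists>\<phi>. shooting_angle b \<mu> M U V \<phi>"
    proof (rule angle_exists, goal_cases)
      case (1 \<phi>)
      show ?case
        by (intro exI[of _ \<phi>], unfold_locales) (rule 1 | assumption)+
    qed
    then obtain \<phi> where "shooting_angle b \<mu> M U V \<phi>" by blast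
    then interpret shooting_angle b \<mu> M U V \<phi> .
    obtain Z where Z: "finite Z" "card Z = 2 * k" "Z \<subseteq> {0<..<1}" "\<And>a. a \<in> Z \<Longrightarrow> U a b = 0"
      using many_zeros[of k] A(2)[OF large(1)] by blast
    define S where "S = (\<lambda>a. restrict (U a) {0..b}) ` Z"
    \<comment> \<open>Evaluation at 0 recovers the initial value, so distinct zeros in
      \<open>Z\<close> give distinct solutions.\<close>
    have at0: "restrict (U a) {0..b} 0 = a" for a using b0 U0 by simp
    have "inj_on (\<lambda>a. restrict (U a) {0..b}) Z" by (rule inj_on_inverseI[where g = "\<lambda>u. u 0"]) (rule at0)
    then have "card S = 2 * k" unfolding S_def using Z(2) by (simp add: card_image)
    moreover have "classical_solution lam \<theta>\<^sub>1 u \<and> u 0 \<in> {0<..<1}" if u: "u \<in> S" for u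
    proof -
      obtain a where a: "a \<in> Z" "u = restrict (U a) {0..b}" using u by (auto simp: S_def)
      then have "classical_solution (- \<mu>) b u" using classical_solution_restrict[of a] Z by blast
      moreover have "u 0 = a" using a(2) at0 by simp
      ultimately show ?thesis using a(1) Z(3) by (auto simp: \<mu>_def b_def)
    qed
    ultimately show ?thesis using Z(1) unfolding S_def by (metis finite_imageI)
  qed
  then show ?thesis using A(1) by blast
qed

end
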